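(* Let $M$ be an $n$-dimensional $C^2$-smooth manifold and $f\colon M\to\mathbb{R}$ a $C^2$-smooth function with a non-degenerate critical point $p^*$. Assume there are a chart $(U_0,\varphi_0)$ on $M$ with $p^*\in U_0$, $\varphi_0(p^* )=0$, and an $\eta>0$, such that $\widehat f=f\circ\varphi_0^{-1}$ satisfies $\|[H_{\widehat f}(x)-H_{\widehat f}(0)]x\|\le\eta\|x\|^2$ for $x\in\varphi_0(U_0)$. Let $\Sigma=\{\Sigma_p\mid p\in M\}$ be a collection of sets $\Sigma_p$ of pairs $(\phi_p,\psi_p)$ of maps $T_pM\to M$ satisfying conditions E0--E2 (defined in the context). Then any whimsical Newton method $p_{k+1}=E^k_f(p_k)$ with respect to $\Sigma$ converges locally quadratically to $p^*$. Moreover the rate of convergence is bounded uniformly: for a given local coordinate chart $\varphi$ around $p^*$ there exist an open neighbourhood $V$ of $p^*$ and a constant $\kappa$, independent of how $E^k_f(p)$ selects which pair $(\phi_p,\psi_p)\in\Sigma_p$ to use at the $k$th step, such that for every whimsical Newton method with respect to $\Sigma$, every $k$ and every $p\in V$, $E^k_f(p)$ is defined, lies in $V$, and $\|\varphi(E^k_f(p))-\varphi(p^* )\|\le\kappa\|\varphi(p)-\varphi(p^* )\|^2$.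
   Context: Notation. $\|\cdot\|$ is the Euclidean norm on $\mathbb{R}^n$; $\nabla g$, $H_g$ are the Euclidean gradient and Hessian; $\|D^2h(x)\|=\sup_{\|\eta\|=1}\|D^2h(x)\cdot(\eta,\eta)\|$. A critical point ($Df(p^* )=0$) is non-degenerate if the Hessian of $f$ there is invertible. The Newton iteration function of a real function $g$ on a finite-dimensional real vector space is $N_g(x)=x-[H_g(x)]^{-1}\nabla g(x)$; it is independent of the choice of inner product and requires only the first and second derivatives of $g$ at $x$. Iteration functions may be only partially defined. $0_p$ is the zero of $T_pM$. Convergence. An iteration function $N$ on $\mathbb{R}^n$ converges locally quadratically to $x^*$ if there are $\kappa$ and an open $U\ni x^*$ such that $N$ is defined on $U$ and for all $x\in U$: $N(x)\in U$ and $\|N(x)-x^*\|\le\kappa\|x-x^*\|^2$. On a manifold, $E$ converges locally quadratically to $p^*$ if $\varphi\circ E\circ\varphi^{-1}$ converges locally quadratically to $\varphi(p^* )$ for some coordinate chart $\varphi$ around $p^*$. Whimsical Newton method. Given $\Sigma$, a whimsical Newton method with respect to $\Sigma$ is any iterative scheme $p_{k+1}=E^k_f(p_k)$ where, for each $k$ and $p$, $E^k_f(p)=\psi_p\circ N_{f\circ\phi_p}(0_p)$ for some pair $(\phi_p,\psi_p)\in\Sigma_p$; the pair chosen may depend on $k$ as well as $p$. For a $C^2$-chart $(U,\varphi)$ and $p\in U$, $A_p\colon T_pM\to\mathbb{R}^n$ is the linear isomorphism sending $\sum_j\eta^j\,\partial/\partial\varphi_j|_p$ to $(\eta^1,\dots,\eta^n)$.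 Conditions E0--E2. $\Sigma_p$ is non-empty for all $p\in M$ and, for every $q\in M$, there exist a $C^2$-chart $(U,\varphi)$ with $\varphi(q)=0$, a $\rho>0$ and $\alpha,\beta\in\mathbb{R}$ such that for all $p\in U$ and all $(\phi_p,\psi_p)\in\Sigma_p$: (E0) $\phi_p(0_p)=\psi_p(0_p)=p$ and $D\phi_p(0_p)=D\psi_p(0_p)=I$ (identifying $T_{0_p}(T_pM)$ with $T_pM$); (E1) $\widehat\phi_p=\varphi\circ\phi_p\circ A_p^{-1}$ satisfies $\|D^2\widehat\phi_p(0)\|\le\alpha$ (in particular this second derivative exists); (E2) $\widehat\psi_p=\varphi\circ\psi_p\circ A_p^{-1}$ satisfies $\|\widehat\psi_p(y)-\varphi(p)-y\|\le\beta\|y\|^2$ whenever $\|y\|<\rho$ (in particular $\widehat\psi_p(y)$ is defined for such $y$). *)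

theory Defs
  imports "HOL-Analysis.Analysis"
begin

definition fderiv :: "('a::real_normed_vector \<Rightarrow> 'b::real_normed_vector) \<Rightarrow> 'a \<Rightarrow> 'a \<Rightarrow>\<^sub>L 'b" where
  "fderiv g x = Blinfun (frechet_derivative g (at x))"

definition twice_differentiable_at ::
    "('a::real_normed_vector \<Rightarrow> 'b::real_normed_vector) \<Rightarrow> 'a \<Rightarrow> bool" where
  "twice_differentiable_at g x \<longleftrightarrow>
     (\<forall>\<^sub>F y in nhds x. g differentiable (at y)) \<and> fderiv g differentiable (at x)"

definition C2_on :: "('a::real_normed_vector \<Rightarrow> 'b::real_normed_vector) \<Rightarrow> 'a set \<Rightarrow> bool" where
  "C2_on g S \<longleftrightarrow> open S \<and> (\<forall>x\<in>S. twice_differentiable_at g x) \<and> continuous_on S (fderiv (fderiv g))"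

definition second_derivative_norm ::
    "('a::real_normed_vector \<Rightarrow> 'b::real_normed_vector) \<Rightarrow> 'a \<Rightarrow> real" where
  "second_derivative_norm g x = (SUP \<eta>\<in>sphere 0 1. norm (fderiv (fderiv g) x \<eta> \<eta>))"

definition gradient :: "(real^'n::finite \<Rightarrow> real) \<Rightarrow> real^'n \<Rightarrow> real^'n" where
  "gradient g x = (\<chi> i. frechet_derivative g (at x) (axis i 1))"

definition hessian :: "(real^'n::finite \<Rightarrow> real) \<Rightarrow> real^'n \<Rightarrow> real^'n^'n" where
  "hessian g x = jacobian (gradient g) (at x)"

text \<open>Partially defined maps are functions into an option type. The extra conjunct is needed
  because the value of \<open>the\<close> outside the domain is an arbitrary constant.\<close>

definition partial_twice_differentiable_at ::
    "('a::real_normed_vector \<rightharpoonup> 'b::real_normed_vector) \<Rightarrow> 'a \<Rightarrow> bool" where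
  "partial_twice_differentiable_at h x \<longleftrightarrow>
     (\<forall>\<^sub>F y in nhds x. y \<in> dom h) \<and> twice_differentiable_at (the \<circ> h) x"

definition newton :: "(real^'n::finite \<rightharpoonup> real) \<Rightarrow> real^'n \<rightharpoonup> real^'n" where
  "newton h x =
     (if partial_twice_differentiable_at h x \<and> invertible (hessian (the \<circ> h) x)
      then Some (x - matrix_inv (hessian (the \<circ> h) x) *v gradient (the \<circ> h) x)
      else None)"

text \<open>The manifold is the whole type \<open>'m\<close>. A chart is a pair of a domain and a coordinate map;
  the values of the coordinate map outside the domain are irrelevant.\<close>

type_synonym ('m, 'n) chart = "'m set \<times> ('m \<Rightarrow> real^'n)"

definition chart_inv :: "('m, 'n::finite) chart \<Rightarrow> real^'n \<Rightarrow> 'm" where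
  "chart_inv c = inv_into (fst c) (snd c)"

definition topological_chart :: "('m::topological_space, 'n::finite) chart \<Rightarrow> bool" where
  "topological_chart c \<longleftrightarrow> open (fst c) \<and> open (snd c ` fst c) \<and>
     homeomorphism (fst c) (snd c ` fst c) (snd c) (chart_inv c)"

definition transition :: "('m, 'n::finite) chart \<Rightarrow> ('m, 'n) chart \<Rightarrow> real^'n \<Rightarrow> real^'n" where
  "transition c d = snd d \<circ> chart_inv c"

definition C2_compatible :: "('m, 'n::finite) chart \<Rightarrow> ('m, 'n) chart \<Rightarrow> bool" where
  "C2_compatible c d \<longleftrightarrow>
     C2_on (transition c d) (snd c ` (fst c \<inter> fst d)) \<and>
     C2_on (transition d c) (snd d ` (fst c \<inter> fst d))"

definition C2_atlas :: "('m::topological_space, 'n::finite) chart set \<Rightarrow> bool" where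
  "C2_atlas A \<longleftrightarrow> (\<forall>c\<in>A. topological_chart c) \<and> (\<Union>c\<in>A. fst c) = UNIV \<and>
     (\<forall>c\<in>A. \<forall>d\<in>A. C2_compatible c d)"

text \<open>The maximal atlas generated by an atlas \<open>A\<close>, and its charts around a point.\<close>

definition C2_charts :: "('m::topological_space, 'n::finite) chart set \<Rightarrow> ('m, 'n) chart set" where
  "C2_charts A = {c. topological_chart c \<and> (\<forall>d\<in>A. C2_compatible c d)}"

definition charts_at ::
    "('m::topological_space, 'n::finite) chart set \<Rightarrow> 'm \<Rightarrow> ('m, 'n) chart set" where
  "charts_at A p = {c \<in> C2_charts A. p \<in> fst c}"

definition C2_function ::
    "('m::topological_space, 'n::finite) chart set \<Rightarrow> ('m \<Rightarrow> real) \<Rightarrow> bool" where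
  "C2_function A f \<longleftrightarrow> (\<forall>c\<in>C2_charts A. C2_on (f \<circ> chart_inv c) (snd c ` fst c))"

definition critical_point ::
    "('m::topological_space, 'n::finite) chart set \<Rightarrow> ('m \<Rightarrow> real) \<Rightarrow> 'm \<Rightarrow> bool" where
  "critical_point A f p \<longleftrightarrow>
     (\<forall>c\<in>charts_at A p. ((f \<circ> chart_inv c) has_derivative (\<lambda>_. 0)) (at (snd c p)))"

definition nondegenerate_critical_point ::
    "('m::topological_space, 'n::finite) chart set \<Rightarrow> ('m \<Rightarrow> real) \<Rightarrow> 'm \<Rightarrow> bool" where
  "nondegenerate_critical_point A f p \<longleftrightarrow> critical_point A f p \<and>
     (\<forall>c\<in>charts_at A p. invertible (hessian (f \<circ> chart_inv c) (snd c p)))"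

text \<open>A tangent vector at \<open>p\<close> is the family of its coordinate vectors in all charts around \<open>p\<close>,
  related by the derivatives of the transition maps. It vanishes by convention at all other
  charts, so that linear operations are pointwise and \<open>\<lambda>_. 0\<close> is the zero vector.\<close>

type_synonym ('m, 'n) tangent = "('m, 'n) chart \<Rightarrow> real^'n"

definition tangent_space ::
    "('m::topological_space, 'n::finite) chart set \<Rightarrow> 'm \<Rightarrow> ('m, 'n) tangent set" where
  "tangent_space A p = {v. (\<forall>c. c \<notin> charts_at A p \<longrightarrow> v c = 0) \<and>
     (\<forall>c\<in>charts_at A p. \<forall>d\<in>charts_at A p.
        v d = frechet_derivative (transition c d) (at (snd c p)) (v c))}"

text \<open>The isomorphism from the tangent space at \<open>p\<close> to Euclidean space given by a chart \<open>c\<close>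
  is \<open>\<lambda>v. v c\<close>; this is its inverse.\<close>

definition tangent_vector ::
    "('m::topological_space, 'n::finite) chart set \<Rightarrow> 'm \<Rightarrow> ('m, 'n) chart \<Rightarrow> real^'n \<Rightarrow> ('m, 'n) tangent"
  where "tangent_vector A p c = inv_into (tangent_space A p) (\<lambda>v. v c)"

definition chart_pmap :: "('m, 'n::finite) chart \<Rightarrow> 'm \<rightharpoonup> real^'n" where
  "chart_pmap c = (\<lambda>p. if p \<in> fst c then Some (snd c p) else None)"

definition chart_pinv :: "('m, 'n::finite) chart \<Rightarrow> real^'n \<rightharpoonup> 'm" where
  "chart_pinv c = (\<lambda>x. if x \<in> snd c ` fst c then Some (chart_inv c x) else None)"

text \<open>Local representative of a map from the tangent space at \<open>p\<close> to the manifold, with the chart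
  \<open>c\<close> inducing the coordinates on the tangent space and the chart \<open>d\<close> those on the manifold.\<close>

definition local_rep ::
    "('m::topological_space, 'n::finite) chart set \<Rightarrow> 'm \<Rightarrow> ('m, 'n) chart \<Rightarrow> ('m, 'n) chart \<Rightarrow>
     (('m, 'n) tangent \<rightharpoonup> 'm) \<Rightarrow> real^'n \<rightharpoonup> real^'n" where
  "local_rep A p c d h = chart_pmap d \<circ>\<^sub>m (h \<circ> tangent_vector A p c)"

text \<open>The map \<open>h\<close> from the tangent space at \<open>p\<close> to the manifold sends the origin to \<open>q\<close> and has
  there the derivative \<open>L\<close>, a map from the tangent space at \<open>p\<close> to the one at \<open>q\<close>.\<close>

definition has_derivative_at_origin ::
    "('m::topological_space, 'n::finite) chart set \<Rightarrow> 'm \<Rightarrow> (('m, 'n) tangent \<rightharpoonup> 'm) \<Rightarrow> 'm \<Rightarrow>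
     (('m, 'n) tangent \<Rightarrow> ('m, 'n) tangent) \<Rightarrow> bool" where
  "has_derivative_at_origin A p h q L \<longleftrightarrow> h (\<lambda>_. 0) = Some q \<and>
     (\<forall>c\<in>charts_at A p. \<forall>d\<in>charts_at A q.
        (\<forall>\<^sub>F y in nhds 0. y \<in> dom (local_rep A p c d h)) \<and>
        ((the \<circ> local_rep A p c d h) has_derivative (\<lambda>y. L (tangent_vector A p c y) d)) (at 0))"

text \<open>The Newton iterate, starting from the origin, of a partially defined real function on the
  tangent space at \<open>p\<close>. Gradient and Hessian are taken with respect to the inner product that some
  chart induces; the result does not depend on that chart.\<close>

definition tangent_newton_at_origin ::
    "('m::topological_space, 'n::finite) chart set \<Rightarrow> 'm \<Rightarrow> (('m, 'n) tangent \<rightharpoonup> real) \<Rightarrow>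
     ('m, 'n) tangent option" where
  "tangent_newton_at_origin A p g =
     (let c = (SOME c. c \<in> charts_at A p)
      in map_option (tangent_vector A p c) (newton (g \<circ> tangent_vector A p c) 0))"

type_synonym ('m, 'n) pairs = "'m \<Rightarrow> ((('m, 'n) tangent \<rightharpoonup> 'm) \<times> (('m, 'n) tangent \<rightharpoonup> 'm)) set"

definition whimsical_newton_method ::
    "('m::topological_space, 'n::finite) chart set \<Rightarrow> ('m \<Rightarrow> real) \<Rightarrow> ('m, 'n) pairs \<Rightarrow>
     (nat \<Rightarrow> 'm \<rightharpoonup> 'm) \<Rightarrow> bool" where
  "whimsical_newton_method A f \<Sigma> E \<longleftrightarrow> (\<forall>k p. \<exists>(\<phi>, \<psi>) \<in> \<Sigma> p.
     E k p = Option.bind (tangent_newton_at_origin A p (map_option f \<circ> \<phi>)) \<psi>)"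

definition E0 ::
    "('m::topological_space, 'n::finite) chart set \<Rightarrow> 'm \<Rightarrow>
     (('m, 'n) tangent \<rightharpoonup> 'm) \<Rightarrow> (('m, 'n) tangent \<rightharpoonup> 'm) \<Rightarrow> bool" where
  "E0 A p \<phi> \<psi> \<longleftrightarrow> has_derivative_at_origin A p \<phi> p (\<lambda>v. v) \<and> has_derivative_at_origin A p \<psi> p (\<lambda>v. v)"

definition E1 ::
    "('m::topological_space, 'n::finite) chart set \<Rightarrow> ('m, 'n) chart \<Rightarrow> real \<Rightarrow> 'm \<Rightarrow>
     (('m, 'n) tangent \<rightharpoonup> 'm) \<Rightarrow> bool" where
  "E1 A c \<alpha> p \<phi> \<longleftrightarrow> partial_twice_differentiable_at (local_rep A p c c \<phi>) 0 \<and>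
     second_derivative_norm (the \<circ> local_rep A p c c \<phi>) 0 \<le> \<alpha>"

definition E2 ::
    "('m::topological_space, 'n::finite) chart set \<Rightarrow> ('m, 'n) chart \<Rightarrow> real \<Rightarrow> real \<Rightarrow> 'm \<Rightarrow>
     (('m, 'n) tangent \<rightharpoonup> 'm) \<Rightarrow> bool" where
  "E2 A c \<rho> \<beta> p \<psi> \<longleftrightarrow> (\<forall>y. norm y < \<rho> \<longrightarrow>
     (\<exists>z. local_rep A p c c \<psi> y = Some z \<and> norm (z - snd c p - y) \<le> \<beta> * (norm y)\<^sup>2))"

definition E0_E2 ::
    "('m::topological_space, 'n::finite) chart set \<Rightarrow> ('m, 'n) pairs \<Rightarrow> bool" where
  "E0_E2 A \<Sigma> \<longleftrightarrow> (\<forall>p. \<Sigma> p \<noteq> {}) \<and>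
     (\<forall>q. \<exists>c\<in>charts_at A q. snd c q = 0 \<and> (\<exists>\<rho> > 0. \<exists>\<alpha> \<beta>.
        \<forall>p\<in>fst c. \<forall>(\<phi>, \<psi>) \<in> \<Sigma> p. E0 A p \<phi> \<psi> \<and> E1 A c \<alpha> p \<phi> \<and> E2 A c \<rho> \<beta> p \<psi>))"

text \<open>The step number may enter the iteration function, in which case the neighbourhood and the
  constant are common to all steps. A stationary iteration is a constant family.\<close>

definition converges_locally_quadratically ::
    "(nat \<Rightarrow> 'a::real_normed_vector \<rightharpoonup> 'a) \<Rightarrow> 'a \<Rightarrow> bool" where
  "converges_locally_quadratically N xs \<longleftrightarrow> (\<exists>\<kappa> U. open U \<and> xs \<in> U \<and>
     (\<forall>k. \<forall>x\<in>U. \<exists>y. N k x = Some y \<and> y \<in> U \<and> norm (y - xs) \<le> \<kappa> * (norm (x - xs))\<^sup>2))"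

definition manifold_converges_locally_quadratically ::
    "('m::topological_space, 'n::finite) chart set \<Rightarrow> (nat \<Rightarrow> 'm \<rightharpoonup> 'm) \<Rightarrow> 'm \<Rightarrow> bool" where
  "manifold_converges_locally_quadratically A E p \<longleftrightarrow> (\<exists>c\<in>charts_at A p.
     converges_locally_quadratically (\<lambda>k. chart_pmap c \<circ>\<^sub>m (E k \<circ>\<^sub>m chart_pinv c)) (snd c p))"

end

theory Submission
  imports Defs
begin

text \<open>Fix the chart \<open>c\<close> around the critical point that conditions E0--E2 provide, let \<open>g\<close> be \<open>f\<close> in
this chart, and let \<open>x\<close> be the coordinates of a point \<open>p\<close>. A pair \<open>(\<phi>, \<psi>)\<close> turns into a map \<open>F\<close>
with \<open>F 0 = x\<close>, \<open>DF(0) = I\<close> and second derivative bounded by a constant that is the same for all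
\<open>p\<close> and all pairs. By the second-order chain rule the Newton step \<open>y\<close> of \<open>g \<circ> F\<close> at the origin
solves \<open>B y = - Dg(x)\<close>, where \<open>B(u, v) = D\<^sup>2g(x)(u, v) + Dg(x)(D\<^sup>2F(0)(u, v))\<close>. Since
\<open>Dg(x) = O(|x|)\<close>, the form \<open>B\<close> is a small perturbation of the non-degenerate form \<open>D\<^sup>2g(0)\<close>, so it is
bounded below uniformly, and
\<open>B (x + y) = (D\<^sup>2g(x) x - Dg(x)) + Dg(x)(D\<^sup>2F(0)(x, \<cdot>))\<close>. The last term is \<open>O(|x|\<^sup>2)\<close> with a
uniform constant. The theorem therefore rests on the bound \<open>D\<^sup>2g(x) x - Dg(x) = O(|x|\<^sup>2)\<close> for what
is called the Newton defect here; it gives \<open>x + y = O(|x|\<^sup>2)\<close> (\<open>newton_step_estimate\<close>), and by E2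
the map \<open>\<psi>\<close> adds only another \<open>O(|y|\<^sup>2)\<close> to this.

In the chart \<open>c0\<close> the defect bound follows from the hypothesis on the Hessian by integrating along
the segment from \<open>0\<close> to \<open>x\<close> (\<open>hessian_condition_imp_newton_defect\<close>). It survives a change of
coordinates \<open>\<tau>\<close>: the derivative of \<open>\<tau>\<close> at \<open>x\<close> maps \<open>x\<close> to \<open>\<tau>(x)\<close> up to \<open>O(|x|\<^sup>2)\<close>, and the term
with \<open>D\<^sup>2\<tau>\<close> carries the factor \<open>Dg = O(|x|)\<close> (\<open>newton_defect_compose\<close>). This is how the hypothesis,
which concerns \<open>c0\<close>, reaches the unrelated chart \<open>c\<close> in which E1 and E2 are stated. Two charts
are locally Lipschitz equivalent, so the final estimate holds in every chart.

Newton's method is used in an inner-product-free form (\<open>newton_eq_Some_iff\<close>), which also makes the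
independence of \<open>tangent_newton_at_origin\<close> from the chosen chart a consequence of linear
invariance. Only the diagonal values of \<open>D\<^sup>2F(0)\<close> are controlled by E1; symmetry of the second
derivative and polarisation extend the bound to all pairs of vectors.\<close>

section \<open>The derivative and the second derivative\<close>

lemma norm_blinfun_apply2:
  fixes T :: "'a::real_normed_vector \<Rightarrow>\<^sub>L 'b::real_normed_vector \<Rightarrow>\<^sub>L 'c::real_normed_vector"
  assumes "norm T \<le> K"
  shows "norm (T u v) \<le> K * norm u * norm v"
proof -
  have "norm (T u v) \<le> norm (T u) * norm v" by (rule norm_blinfun)
  also have "\<dots> \<le> (norm T * norm u) * norm v"
    by (intro mult_right_mono norm_blinfun) simp
  also have "\<dots> \<le> (K * norm u) * norm v"
    using assms by (intro mult_right_mono) auto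
  finally show ?thesis .
qed

lemma norm_blinfun_apply1:
  assumes "norm D \<le> K"
  shows "norm (blinfun_apply D v) \<le> K * norm v"
  using norm_blinfun[of D v] mult_right_mono[OF assms norm_ge_zero[of v]] by linarith

lemma has_derivative_fderiv:
  assumes "g differentiable (at x)"
  shows "(g has_derivative blinfun_apply (fderiv g x)) (at x)"
proof -
  have "bounded_linear (frechet_derivative g (at x))"
    using assms frechet_derivative_works has_derivative_bounded_linear by blast
  then show ?thesis
    using assms by (simp add: fderiv_def bounded_linear_Blinfun_apply frechet_derivative_works)
qed

lemma fderiv_eqI:
  assumes "(g has_derivative blinfun_apply D) (at x)"
  shows "fderiv g x = D"
  using frechet_derivative_at[OF assms] by (metis fderiv_def blinfun_apply_inverse)

lemma blinfun_apply_fderiv: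
  assumes "g differentiable (at x)"
  shows "blinfun_apply (fderiv g x) = frechet_derivative g (at x)"
  using has_derivative_fderiv[OF assms] frechet_derivative_at by blast

lemma has_derivative_cong_nhds:
  assumes ev: "\<forall>\<^sub>F y in nhds x. g y = h y"
  shows "(g has_derivative D) (at x) \<longleftrightarrow> (h has_derivative D) (at x)"
proof -
  have ev': "\<forall>\<^sub>F y in at x. g y = h y"
    using ev by (simp add: eventually_nhds_conv_at)
  have eq: "g x = h x" using eventually_nhds_x_imp_x[OF ev] .
  show ?thesis
    using has_derivative_transform_eventually[of g D x UNIV h]
      has_derivative_transform_eventually[of h D x UNIV g] ev' eq
    by (auto simp: eq_commute)
qed

text \<open>The conclusion is again an eventual equality, so the lemma can be applied twice to reach the
second derivative.\<close>

lemma eventually_fderiv_cong: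
  assumes "\<forall>\<^sub>F y in nhds x. g y = h y"
  shows "\<forall>\<^sub>F y in nhds x. fderiv g y = fderiv h y"
proof -
  have "\<forall>\<^sub>F y in nhds x. \<forall>\<^sub>F z in nhds y. g z = h z"
    using assms by (simp add: eventually_eventually)
  then show ?thesis
  proof eventually_elim
    case (elim y)
    have "(g has_derivative D) (at y) \<longleftrightarrow> (h has_derivative D) (at y)" for D
      by (rule has_derivative_cong_nhds[OF elim])
    then show ?case
      by (simp add: fderiv_def frechet_derivative_def)
  qed
qed

lemma differentiable_cong_nhds:
  assumes "\<forall>\<^sub>F y in nhds x. g y = h y"
  shows "g differentiable (at x) \<longleftrightarrow> h differentiable (at x)"
proof -
  have "(g has_derivative D) (at x) \<longleftrightarrow> (h has_derivative D) (at x)" for D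
    by (rule has_derivative_cong_nhds[OF assms])
  then show ?thesis by (simp add: differentiable_def)
qed

lemma fderiv_cong_nhds:
  assumes "\<forall>\<^sub>F y in nhds x. g y = h y"
  shows "fderiv g x = fderiv h x"
  using eventually_nhds_x_imp_x[OF eventually_fderiv_cong[OF assms]] .

lemma fderiv2_cong_nhds:
  assumes "\<forall>\<^sub>F y in nhds x. g y = h y"
  shows "fderiv (fderiv g) x = fderiv (fderiv h) x"
  by (intro fderiv_cong_nhds eventually_fderiv_cong assms)

lemma twice_differentiable_at_cong:
  assumes ev: "\<forall>\<^sub>F y in nhds x. g y = h y"
  shows "twice_differentiable_at g x \<longleftrightarrow> twice_differentiable_at h x"
proof -
  have "\<forall>\<^sub>F y in nhds x. \<forall>\<^sub>F z in nhds y. g z = h z"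
    using ev by (simp add: eventually_eventually)
  then have *: "\<forall>\<^sub>F y in nhds x. g differentiable (at y) \<longleftrightarrow> h differentiable (at y)"
    by eventually_elim (rule differentiable_cong_nhds)
  have "(\<forall>\<^sub>F y in nhds x. g differentiable (at y)) \<longleftrightarrow> (\<forall>\<^sub>F y in nhds x. h differentiable (at y))"
    by (rule eventually_cong[OF *]) simp
  then show ?thesis
    unfolding twice_differentiable_at_def
    using differentiable_cong_nhds[OF eventually_fderiv_cong[OF ev]] by simp
qed

lemma twice_differentiable_at_imp_differentiable:
  "twice_differentiable_at g x \<Longrightarrow> g differentiable (at x)"
  unfolding twice_differentiable_at_def by (blast dest: eventually_nhds_x_imp_x)

lemma twice_differentiable_at_has_derivative:
  assumes "twice_differentiable_at g x"
  shows "(g has_derivative blinfun_apply (fderiv g x)) (at x)"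
    and "(fderiv g has_derivative blinfun_apply (fderiv (fderiv g) x)) (at x)"
  using assms has_derivative_fderiv twice_differentiable_at_imp_differentiable
  by (auto simp: twice_differentiable_at_def)

lemma eventually_nhds_continuous:
  assumes "isCont F x" "\<forall>\<^sub>F z in nhds (F x). P z"
  shows "\<forall>\<^sub>F y in nhds x. P (F y)"
  using assms eventually_compose_filterlim tendsto_at_iff_tendsto_nhds
  unfolding continuous_at by blast

text \<open>Near \<open>x\<close> the derivative of \<open>g \<circ> F\<close> is the product of \<open>y \<mapsto> fderiv g (F y)\<close> and \<open>fderiv F\<close> under
composition of linear maps, which is bounded bilinear; the second derivative is then given by the
product rule. Only differentiability of \<open>fderiv F\<close> at the single point \<open>x\<close> enters, which is all
that condition E1 offers.\<close>

lemma twice_differentiable_at_compose: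
  assumes F: "twice_differentiable_at F x" and g: "twice_differentiable_at g (F x)"
  shows "twice_differentiable_at (g \<circ> F) x"
    and "fderiv (g \<circ> F) x = fderiv g (F x) o\<^sub>L fderiv F x"
    and "fderiv (fderiv (g \<circ> F)) x u v =
      fderiv (fderiv g) (F x) (fderiv F x u) (fderiv F x v) + fderiv g (F x) (fderiv (fderiv F) x u v)"
proof -
  have cont: "isCont F x"
    using twice_differentiable_at_imp_differentiable[OF F] differentiable_imp_continuous_within by blast
  have "\<forall>\<^sub>F y in nhds x. g differentiable (at (F y))"
    using eventually_nhds_continuous[OF cont, of "\<lambda>z. g differentiable (at z)"] g
    by (simp add: twice_differentiable_at_def)
  moreover have "\<forall>\<^sub>F y in nhds x. F differentiable (at y)"
    using F by (simp add: twice_differentiable_at_def)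
  ultimately have ev: "\<forall>\<^sub>F y in nhds x. (g \<circ> F) differentiable (at y) \<and>
      fderiv (g \<circ> F) y = fderiv g (F y) o\<^sub>L fderiv F y"
  proof eventually_elim
    case (elim y)
    have "((g \<circ> F) has_derivative (fderiv g (F y) o\<^sub>L fderiv F y)) (at y)"
      using diff_chain_at[OF has_derivative_fderiv[OF elim(2)] has_derivative_fderiv[OF elim(1)]]
      by (simp add: o_def blinfun_compose.rep_eq)
    then show ?case
      using fderiv_eqI differentiable_def by blast
  qed
  then have ev1: "\<forall>\<^sub>F y in nhds x. fderiv (g \<circ> F) y = fderiv g (F y) o\<^sub>L fderiv F y"
    by (simp add: eventually_conj_iff)
  show "fderiv (g \<circ> F) x = fderiv g (F x) o\<^sub>L fderiv F x"
    using eventually_nhds_x_imp_x[OF ev1] .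
  note dF = twice_differentiable_at_has_derivative[OF F]
  note dg = twice_differentiable_at_has_derivative[OF g]
  have 1: "((\<lambda>y. fderiv g (F y)) has_derivative (\<lambda>u. fderiv (fderiv g) (F x) (fderiv F x u))) (at x)"
    using diff_chain_at[OF dF(1) dg(2)] by (simp add: o_def)
  define D where "D = (\<lambda>u. (fderiv g (F x) o\<^sub>L fderiv (fderiv F) x u)
      + (fderiv (fderiv g) (F x) (fderiv F x u) o\<^sub>L fderiv F x))"
  have 2: "((\<lambda>y. fderiv g (F y) o\<^sub>L fderiv F y) has_derivative D) (at x)"
    unfolding D_def
    by (rule bounded_bilinear.FDERIV[OF bounded_bilinear_blinfun_compose 1 dF(2)])
  have 3: "(fderiv (g \<circ> F) has_derivative D) (at x)"
    using 2 has_derivative_cong_nhds[OF ev1] by blast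
  show "twice_differentiable_at (g \<circ> F) x"
    unfolding twice_differentiable_at_def
    using ev 3 by (auto simp: eventually_conj_iff differentiable_def)
  have "bounded_linear D" using 3 has_derivative_bounded_linear by blast
  then have "fderiv (fderiv (g \<circ> F)) x = Blinfun D"
    using 3 by (intro fderiv_eqI) (simp add: bounded_linear_Blinfun_apply)
  then show "fderiv (fderiv (g \<circ> F)) x u v =
      fderiv (fderiv g) (F x) (fderiv F x u) (fderiv F x v) + fderiv g (F x) (fderiv (fderiv F) x u v)"
    using \<open>bounded_linear D\<close>
    by (simp add: bounded_linear_Blinfun_apply D_def blinfun.bilinear_simps)
qed

lemma twice_differentiable_at_linear:
  fixes L :: "'a::real_normed_vector \<Rightarrow> 'b::real_normed_vector"
  assumes "bounded_linear L"
  shows "twice_differentiable_at L x" "fderiv L x v = L v" "fderiv (fderiv L) x = 0"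
proof -
  have d: "(L has_derivative Blinfun L) (at y)" for y
    using assms by (simp add: bounded_linear_Blinfun_apply bounded_linear_imp_has_derivative)
  have f: "fderiv L = (\<lambda>y. Blinfun L)"
    using fderiv_eqI[OF d] by auto
  have *: "(fderiv L has_derivative blinfun_apply 0) (at x)"
    unfolding f by (simp add: zero_blinfun.rep_eq)
  show "fderiv (fderiv L) x = 0"
    by (rule fderiv_eqI[OF *])
  show "twice_differentiable_at L x"
    using d * by (auto simp: twice_differentiable_at_def differentiable_def intro!: always_eventually)
  show "fderiv L x v = L v" using f assms by (simp add: bounded_linear_Blinfun_apply)
qed

text \<open>The second difference is the increment of \<open>s \<mapsto> F(x + u + s v) - F(x + s v)\<close> over the unit interval.
Its derivative is a difference of two values of \<open>DF\<close>, each of which is approximated by the affine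
expansion of \<open>DF\<close> at \<open>x\<close>, so the mean value inequality compares it with \<open>T u v\<close>.\<close>

lemma second_difference_bound:
  fixes F :: "'a::real_normed_vector \<Rightarrow> 'b::real_normed_vector"
  assumes diff: "\<And>y. norm (y - x) < \<delta> \<Longrightarrow> F differentiable (at y)"
    and lin: "\<And>y. norm (y - x) < \<delta> \<Longrightarrow>
      norm (fderiv F y - fderiv F x - blinfun_apply T (y - x)) \<le> \<epsilon> * norm (y - x)"
    and small: "norm u + norm v < \<delta>" and "\<epsilon> \<ge> 0"
  shows "norm (F (x + u + v) - F (x + u) - F (x + v) + F x - blinfun_apply (T u) v)
    \<le> 2 * \<epsilon> * (norm u + norm v)\<^sup>2"
proof -
  define G where "G = (\<lambda>s::real. F (x + u + s *\<^sub>R v) - F (x + s *\<^sub>R v) - s *\<^sub>R T u v)"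
  define G' where "G' = (\<lambda>s::real. \<lambda>h::real. h *\<^sub>R ((fderiv F (x + u + s *\<^sub>R v) - fderiv F (x + s *\<^sub>R v) - T u) v))"
  have near: "norm (u + s *\<^sub>R v) < \<delta>" "norm (s *\<^sub>R v) < \<delta>"
     "norm (u + s *\<^sub>R v) \<le> norm u + norm v" "norm (s *\<^sub>R v) \<le> norm u + norm v"
    if "s \<in> {0..1}" for s
  proof -
    have "norm (s *\<^sub>R v) \<le> norm v" using that by (simp add: mult_left_le_one_le)
    moreover have "norm (u + s *\<^sub>R v) \<le> norm u + norm (s *\<^sub>R v)" by (rule norm_triangle_ineq)
    moreover have "0 \<le> norm u" by simp
    ultimately show "norm (u + s *\<^sub>R v) < \<delta>" "norm (s *\<^sub>R v) < \<delta>"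
     "norm (u + s *\<^sub>R v) \<le> norm u + norm v" "norm (s *\<^sub>R v) \<le> norm u + norm v"
      using small by linarith+
  qed
  have "norm (G 1 - G 0) \<le> (2 * \<epsilon> * (norm u + norm v) * norm v) * norm (1 - 0 :: real)"
  proof (rule differentiable_bound[where S = "{0..1}" and f' = G'])
    fix s :: real assume s: "s \<in> {0..1}"
    have 1: "((\<lambda>s. F (x + u + s *\<^sub>R v)) has_derivative (\<lambda>h. fderiv F (x + u + s *\<^sub>R v) (h *\<^sub>R v))) (at s within {0..1})"
    proof (rule has_derivative_compose[where f="\<lambda>s. x + u + s *\<^sub>R v"])
      show "(F has_derivative blinfun_apply (fderiv F (x + u + s *\<^sub>R v))) (at (x + u + s *\<^sub>R v))"
        using near(1)[OF s] by (intro has_derivative_fderiv diff) (simp add: algebra_simps)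
    qed (auto intro!: derivative_eq_intros)
    have 2: "((\<lambda>s. F (x + s *\<^sub>R v)) has_derivative (\<lambda>h. fderiv F (x + s *\<^sub>R v) (h *\<^sub>R v))) (at s within {0..1})"
    proof (rule has_derivative_compose[where f="\<lambda>s. x + s *\<^sub>R v"])
      show "(F has_derivative blinfun_apply (fderiv F (x + s *\<^sub>R v))) (at (x + s *\<^sub>R v))"
        using near(2)[OF s] by (intro has_derivative_fderiv diff) (simp add: algebra_simps)
    qed (auto intro!: derivative_eq_intros)
    show "(G has_derivative G' s) (at s within {0..1})"
      unfolding G_def
      by (rule has_derivative_eq_rhs[OF has_derivative_diff[OF has_derivative_diff[OF 1 2]
            has_derivative_scaleR_left[OF has_derivative_ident]]])
        (simp add: G'_def blinfun.bilinear_simps fun_eq_iff scaleR_diff_right)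
    define E1 where "E1 = fderiv F (x + u + s *\<^sub>R v) - fderiv F x - T (u + s *\<^sub>R v)"
    define E2 where "E2 = fderiv F (x + s *\<^sub>R v) - fderiv F x - T (s *\<^sub>R v)"
    have "norm E1 \<le> \<epsilon> * norm (u + s *\<^sub>R v)"
      using lin[of "x + u + s *\<^sub>R v"] near(1)[OF s] by (simp add: E1_def add.assoc)
    also have "\<dots> \<le> \<epsilon> * (norm u + norm v)"
      using near(3)[OF s] \<open>\<epsilon> \<ge> 0\<close> by (intro mult_left_mono)
    finally have E1: "norm E1 \<le> \<epsilon> * (norm u + norm v)" .
    have "norm E2 \<le> \<epsilon> * norm (s *\<^sub>R v)"
      using lin[of "x + s *\<^sub>R v"] near(2)[OF s] by (simp add: E2_def)
    also have "\<dots> \<le> \<epsilon> * (norm u + norm v)"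
      using near(4)[OF s] \<open>\<epsilon> \<ge> 0\<close> by (intro mult_left_mono)
    finally have E2: "norm E2 \<le> \<epsilon> * (norm u + norm v)" .
    have G'E: "fderiv F (x + u + s *\<^sub>R v) - fderiv F (x + s *\<^sub>R v) - T u = E1 - E2"
      by (simp add: E1_def E2_def blinfun.bilinear_simps)
    show "onorm (G' s) \<le> 2 * \<epsilon> * (norm u + norm v) * norm v"
    proof (rule onorm_le)
      fix h :: real
      have "norm ((E1 - E2) v) \<le> norm (E1 - E2) * norm v" by (rule norm_blinfun)
      also have "\<dots> \<le> (2 * \<epsilon> * (norm u + norm v)) * norm v"
        using norm_triangle_ineq4[of E1 E2] E1 E2 by (intro mult_right_mono) auto
      finally show "norm (G' s h) \<le> 2 * \<epsilon> * (norm u + norm v) * norm v * norm h"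
        unfolding G'_def G'E by (simp add: mult.commute mult_left_mono)
    qed
  qed auto
  also have "\<dots> \<le> 2 * \<epsilon> * (norm u + norm v)\<^sup>2"
    using \<open>\<epsilon> \<ge> 0\<close> by (auto simp: power2_eq_square mult.assoc intro!: mult_left_mono)
  also have "G 1 - G 0 = F (x + u + v) - F (x + u) - F (x + v) + F x - T u v"
    by (simp add: G_def)
  finally show ?thesis .
qed

text \<open>The second difference does not change when \<open>u\<close> and \<open>v\<close> are exchanged, and for small \<open>t\<close> it is
close both to \<open>t\<^sup>2 D\<^sup>2F(x)(u, v)\<close> and to \<open>t\<^sup>2 D\<^sup>2F(x)(v, u)\<close>. Continuity of the second derivative is not
available for the maps in question, hence the argument at a single point.\<close>

lemma fderiv2_symmetric:
  assumes F: "twice_differentiable_at F x"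
  shows "fderiv (fderiv F) x u v = fderiv (fderiv F) x v u"
proof -
  define T where "T = fderiv (fderiv F) x"
  define N where "N = norm u + norm v"
  have bound: "norm (T u v - T v u) \<le> 4 * \<epsilon> * N\<^sup>2" if "\<epsilon> > 0" for \<epsilon>
  proof -
    have "(fderiv F has_derivative T) (at x)"
      using twice_differentiable_at_has_derivative(2)[OF F] by (simp add: T_def)
    then have "\<exists>d>0. \<forall>y. norm (y - x) < d \<longrightarrow>
        norm (fderiv F y - fderiv F x - T (y - x)) \<le> \<epsilon> * norm (y - x)"
      using that by (simp add: has_derivative_at_alt)
    then obtain d1 where d1: "d1 > 0" "\<And>y. norm (y - x) < d1 \<Longrightarrow>
        norm (fderiv F y - fderiv F x - T (y - x)) \<le> \<epsilon> * norm (y - x)"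
      by blast
    obtain d2 where d2: "d2 > 0" "\<And>y. norm (y - x) < d2 \<Longrightarrow> F differentiable (at y)"
      using F by (auto simp: twice_differentiable_at_def eventually_nhds_metric dist_norm)
    define \<delta> where "\<delta> = min d1 d2"
    have "N \<ge> 0" by (simp add: N_def)
    \<comment> \<open>the factor \<open>t\<close> brings both \<open>t u\<close> and \<open>t v\<close> into the ball where the expansion of \<open>DF\<close> is valid\<close>
    define t where "t = \<delta> / (2 * (N + 1))"
    have t: "t > 0" using d1(1) d2(1) \<open>N \<ge> 0\<close> by (simp add: t_def \<delta>_def)
    have "\<delta> > 0" using d1(1) d2(1) by (simp add: \<delta>_def)
    moreover have "t * (2 * (N + 1)) = \<delta>" using \<open>N \<ge> 0\<close> by (simp add: t_def)
    moreover have "t * N \<ge> 0" using t \<open>N \<ge> 0\<close> by simp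
    ultimately have "t * N < \<delta>" using t by (simp add: algebra_simps)
    then have small: "norm (t *\<^sub>R u) + norm (t *\<^sub>R v) < \<delta>" "norm (t *\<^sub>R v) + norm (t *\<^sub>R u) < \<delta>"
      using t by (auto simp: N_def algebra_simps)
    define \<Delta> where "\<Delta> = F (x + t *\<^sub>R u + t *\<^sub>R v) - F (x + t *\<^sub>R u) - F (x + t *\<^sub>R v) + F x"
    have 1: "norm (\<Delta> - T (t *\<^sub>R u) (t *\<^sub>R v)) \<le> 2 * \<epsilon> * (t * N)\<^sup>2"
      using second_difference_bound[OF d2(2) d1(2), of \<delta> "t *\<^sub>R u" "t *\<^sub>R v"] small(1) that t
      by (simp add: \<Delta>_def N_def \<delta>_def distrib_left)
    have 2: "norm (\<Delta> - T (t *\<^sub>R v) (t *\<^sub>R u)) \<le> 2 * \<epsilon> * (t * N)\<^sup>2"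
      using second_difference_bound[OF d2(2) d1(2), of \<delta> "t *\<^sub>R v" "t *\<^sub>R u"] small(2) that t
      by (simp add: \<Delta>_def N_def \<delta>_def distrib_left algebra_simps)
    have "t\<^sup>2 * norm (T u v - T v u) = norm ((\<Delta> - T (t *\<^sub>R v) (t *\<^sub>R u)) - (\<Delta> - T (t *\<^sub>R u) (t *\<^sub>R v)))"
      using t by (simp add: blinfun.bilinear_simps power2_eq_square flip: scaleR_diff_right)
    also have "\<dots> \<le> 4 * \<epsilon> * (t * N)\<^sup>2"
      using 1 2 norm_triangle_ineq4[of "\<Delta> - T (t *\<^sub>R v) (t *\<^sub>R u)" "\<Delta> - T (t *\<^sub>R u) (t *\<^sub>R v)"] by simp
    finally have "t\<^sup>2 * norm (T u v - T v u) \<le> t\<^sup>2 * (4 * \<epsilon> * N\<^sup>2)"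
      by (simp add: power_mult_distrib mult_ac)
    then show ?thesis using t by simp
  qed
  have "norm (T u v - T v u) \<le> 0"
  proof (rule field_le_epsilon)
    fix e :: real assume "e > 0"
    define \<epsilon> where "\<epsilon> = e / (4 * (N\<^sup>2 + 1))"
    have N1: "N\<^sup>2 + 1 > 0" by (simp add: add_nonneg_pos)
    have "\<epsilon> > 0" using \<open>e > 0\<close> N1 by (simp add: \<epsilon>_def)
    then have "norm (T u v - T v u) \<le> 4 * \<epsilon> * N\<^sup>2" by (rule bound)
    moreover have "\<epsilon> * (4 * (N\<^sup>2 + 1)) = e" using N1 by (simp add: \<epsilon>_def)
    ultimately have "norm (T u v - T v u) \<le> e" using \<open>\<epsilon> > 0\<close> by (simp add: algebra_simps)
    then show "norm (T u v - T v u) \<le> 0 + e" by simp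
  qed
  then show ?thesis by (simp add: T_def)
qed

text \<open>Polarisation, \<open>4 T(u, v) = T(u + v, u + v) - T(u - v, u - v)\<close>, applied to unit vectors and
extended by homogeneity. The factor 2 comes from the triangle inequality for \<open>u \<plusminus> v\<close>.\<close>

lemma symmetric_bilinear_bound:
  fixes T :: "'a::real_normed_vector \<Rightarrow>\<^sub>L 'a \<Rightarrow>\<^sub>L 'b::real_normed_vector"
  assumes sym: "\<And>u v. T u v = T v u" and diag: "\<And>u. norm u = 1 \<Longrightarrow> norm (T u u) \<le> \<alpha>" and "\<alpha> \<ge> 0"
  shows "norm (T u v) \<le> 2 * \<alpha> * norm u * norm v"
proof -
  have diag': "norm (T u u) \<le> \<alpha> * (norm u)\<^sup>2" for u
  proof (cases "u = 0")
    case False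
    then have "norm (T (u /\<^sub>R norm u) (u /\<^sub>R norm u)) \<le> \<alpha>" by (intro diag) simp
    then show ?thesis using False
      by (simp add: blinfun.bilinear_simps divide_simps power2_eq_square mult_ac)
  qed (simp add: blinfun.bilinear_simps)
  have unit: "norm (T u v) \<le> 2 * \<alpha>" if "norm u = 1" "norm v = 1" for u v
  proof -
    have le: "norm (T w w) \<le> 4 * \<alpha>" if "norm w \<le> 2" for w
    proof -
      have "(norm w)\<^sup>2 \<le> 2\<^sup>2" using that by (intro power_mono) auto
      then show ?thesis using diag'[of w] mult_left_mono[of "(norm w)\<^sup>2" 4 \<alpha>] \<open>\<alpha> \<ge> 0\<close> by simp
    qed
    have "T (u + v) (u + v) - T (u - v) (u - v) = (T u v + T u v) + (T u v + T u v)"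
      using sym[of v u] by (simp add: blinfun.bilinear_simps)
    also have "\<dots> = 4 *\<^sub>R T u v" by (simp flip: scaleR_2)
    finally have "4 * norm (T u v) = norm (T (u + v) (u + v) - T (u - v) (u - v))"
      by simp
    also have "\<dots> \<le> 4 * \<alpha> + 4 * \<alpha>"
      using le[of "u + v"] le[of "u - v"] norm_triangle_ineq[of u v] norm_triangle_ineq4[of u v] that
        norm_triangle_ineq4[of "T (u + v) (u + v)" "T (u - v) (u - v)"] by simp
    finally show ?thesis by simp
  qed
  show ?thesis
  proof (cases "u = 0 \<or> v = 0")
    case False
    then have "norm (T (u /\<^sub>R norm u) (v /\<^sub>R norm v)) \<le> 2 * \<alpha>" by (intro unit) auto
    then show ?thesis using False
      by (simp add: blinfun.bilinear_simps divide_simps mult_ac)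
  qed (auto simp: blinfun.bilinear_simps)
qed

lemma norm_fderiv2_le_second_derivative_norm:
  fixes F :: "'a::euclidean_space \<Rightarrow> 'b::real_normed_vector"
  assumes F: "twice_differentiable_at F x" and le: "second_derivative_norm F x \<le> \<alpha>"
  shows "norm (fderiv (fderiv F) x u v) \<le> 2 * \<alpha> * norm u * norm v"
proof -
  define T where "T = fderiv (fderiv F) x"
  have diag: "norm (T u u) \<le> \<alpha>" if "norm u = 1" for u
  proof -
    have "bdd_above ((\<lambda>u. norm (T u u)) ` sphere 0 1)"
    proof (rule bdd_aboveI2)
      fix u :: 'a assume "u \<in> sphere 0 1"
      then show "norm (T u u) \<le> norm T"
        using norm_blinfun[of "T u" u] norm_blinfun[of T u] by simp
    qed
    then have "norm (T u u) \<le> second_derivative_norm F x"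
      unfolding second_derivative_norm_def T_def using that by (intro cSUP_upper) auto
    then show ?thesis using le by simp
  qed
  obtain b :: 'a where "b \<in> Basis" using nonempty_Basis by blast
  then have "norm (T b b) \<le> \<alpha>" by (intro diag) simp
  then have "\<alpha> \<ge> 0" using norm_ge_zero order_trans by blast
  then have "norm (T u v) \<le> 2 * \<alpha> * norm u * norm v"
    by (intro symmetric_bilinear_bound diag) (auto simp: T_def fderiv2_symmetric[OF F])
  then show ?thesis by (simp add: T_def)
qed

section \<open>Newton steps of partially defined functions\<close>

lemma inner_vec_of_functional:
  fixes D :: "(real^'n) \<Rightarrow>\<^sub>L real"
  shows "(\<chi> i. D (axis i 1)) \<bullet> v = D v"
proof -
  have "D v = D (\<Sum>i\<in>UNIV. v $ i *\<^sub>R axis i 1)"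
    using basis_expansion[of v] by (simp add: scalar_mult_eq_scaleR)
  then show ?thesis
    by (simp add: blinfun.bilinear_simps inner_vec_def mult.commute)
qed

lemma inner_gradient:
  assumes "g differentiable (at x)"
  shows "gradient g x \<bullet> v = fderiv g x v"
proof -
  have "gradient g x = (\<chi> i. fderiv g x (axis i 1))"
    by (simp add: gradient_def blinfun_apply_fderiv[OF assms])
  then show ?thesis using inner_vec_of_functional by simp
qed

text \<open>The Hessian is the Jacobian of the gradient, and the gradient is the image of \<open>fderiv g\<close> under the
linear map \<open>J\<close> that represents functionals by vectors. Hence the Hessian represents the second
derivative, the vector that it multiplies being the direction in which \<open>fderiv g\<close> is differentiated.\<close>

lemma inner_hessian:
  fixes g :: "real^'n \<Rightarrow> real"
  assumes g: "twice_differentiable_at g x"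
  shows "(hessian g x *v u) \<bullet> v = fderiv (fderiv g) x u v"
proof -
  define J where "J = (\<lambda>D :: (real^'n) \<Rightarrow>\<^sub>L real. \<chi> i. D (axis i 1))"
  have "((\<lambda>y. J (fderiv g y)) has_derivative (\<lambda>u. J (fderiv (fderiv g) x u))) (at x)"
  proof (subst has_derivative_componentwise_within, intro ballI)
    fix b :: "real^'n" assume "b \<in> Basis"
    then obtain i where b: "b = axis i 1" by (auto simp: Basis_vec_def)
    have "((\<lambda>y. fderiv g y b) has_derivative (\<lambda>u. fderiv (fderiv g) x u b)) (at x)"
      by (rule blinfun.FDERIV[OF twice_differentiable_at_has_derivative(2)[OF g] has_derivative_const,
            THEN has_derivative_eq_rhs]) (simp add: blinfun.bilinear_simps)
    then show "((\<lambda>y. J (fderiv g y) \<bullet> b) has_derivative (\<lambda>u. J (fderiv (fderiv g) x u) \<bullet> b)) (at x)"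
      by (simp add: J_def b inner_axis)
  qed
  moreover have "\<forall>\<^sub>F y in nhds x. J (fderiv g y) = gradient g y"
    using g unfolding twice_differentiable_at_def
    by (auto elim!: eventually_mono simp: J_def gradient_def blinfun_apply_fderiv)
  ultimately have d: "(gradient g has_derivative (\<lambda>u. J (fderiv (fderiv g) x u))) (at x)"
    using has_derivative_cong_nhds[of "\<lambda>y. J (fderiv g y)" "gradient g" x] by simp
  then have "(gradient g has_derivative (\<lambda>u. hessian g x *v u)) (at x)"
    unfolding hessian_def using jacobian_works differentiable_def by blast
  then have "(\<lambda>u. hessian g x *v u) = (\<lambda>u. J (fderiv (fderiv g) x u))"
    using d has_derivative_unique by blast
  then have "hessian g x *v u = J (fderiv (fderiv g) x u)" by metis
  then show ?thesis
    using inner_vec_of_functional[of "fderiv (fderiv g) x u" v] by (simp add: J_def)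
qed

lemma hessian_mult_eq_0_iff:
  assumes "twice_differentiable_at g x"
  shows "hessian g x *v u = 0 \<longleftrightarrow> fderiv (fderiv g) x u = 0"
proof -
  have "hessian g x *v u = 0 \<longleftrightarrow> (\<forall>v. (hessian g x *v u) \<bullet> v = 0)"
    by (metis inner_eq_zero_iff inner_zero_left)
  also have "\<dots> \<longleftrightarrow> fderiv (fderiv g) x u = 0"
    by (auto simp: inner_hessian[OF assms] intro!: blinfun_eqI)
  finally show ?thesis .
qed

lemma invertible_hessian_iff:
  assumes "twice_differentiable_at g x"
  shows "invertible (hessian g x) \<longleftrightarrow> (\<forall>u. fderiv (fderiv g) x u = 0 \<longrightarrow> u = 0)"
  unfolding invertible_left_inverse matrix_left_invertible_ker hessian_mult_eq_0_iff[OF assms] ..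

lemma matrix_inv_mult_eq_iff:
  fixes B :: "real^'n^'n"
  assumes "invertible B"
  shows "matrix_inv B *v w = y \<longleftrightarrow> B *v y = w"
proof -
  have "B ** matrix_inv B = mat 1 \<and> matrix_inv B ** B = mat 1"
    using assms unfolding invertible_def matrix_inv_def by (rule someI_ex)
  then show ?thesis by (metis matrix_vector_mul_assoc matrix_vector_mul_lid)
qed

text \<open>Gradient and Hessian disappear from this description of the Newton iterate, which is therefore
stable under linear changes of coordinates and can be fed directly with the chain rule.\<close>

lemma newton_eq_Some_iff:
  "newton h x = Some y \<longleftrightarrow> partial_twice_differentiable_at h x \<and>
     (\<forall>u. fderiv (fderiv (the \<circ> h)) x u = 0 \<longrightarrow> u = 0) \<and>
     fderiv (fderiv (the \<circ> h)) x (y - x) = - fderiv (the \<circ> h) x"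
proof (cases "partial_twice_differentiable_at h x \<and> invertible (hessian (the \<circ> h) x)")
  case True
  define g where "g = the \<circ> h"
  have g: "twice_differentiable_at g x"
    using True by (simp add: partial_twice_differentiable_at_def g_def)
  have "newton h x = Some y \<longleftrightarrow> matrix_inv (hessian g x) *v gradient g x = x - y"
    using True by (auto simp: newton_def g_def algebra_simps)
  also have "\<dots> \<longleftrightarrow> hessian g x *v (x - y) = gradient g x"
    using True by (intro matrix_inv_mult_eq_iff) (simp add: g_def)
  also have "\<dots> \<longleftrightarrow> (\<forall>v. (hessian g x *v (x - y)) \<bullet> v = gradient g x \<bullet> v)"
    by (simp add: vector_eq_rdot)
  also have "\<dots> \<longleftrightarrow> fderiv (fderiv g) x (x - y) = fderiv g x"
    by (auto simp: inner_hessian[OF g] inner_gradient[OF twice_differentiable_at_imp_differentiable[OF g]]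
        intro!: blinfun_eqI)
  also have "\<dots> \<longleftrightarrow> fderiv (fderiv g) x (y - x) = - fderiv g x"
    using blinfun.minus_right[of "fderiv (fderiv g) x" "x - y"] by (auto simp: neg_equal_iff_equal)
  finally show ?thesis
    using True g by (simp add: g_def invertible_hessian_iff)
next
  case False
  then show ?thesis
    by (auto simp: newton_def invertible_hessian_iff partial_twice_differentiable_at_def)
qed

lemma newton_defined_iff:
  "(\<exists>y. newton h x = Some y) \<longleftrightarrow> partial_twice_differentiable_at h x \<and>
     (\<forall>u. fderiv (fderiv (the \<circ> h)) x u = 0 \<longrightarrow> u = 0)"
proof -
  have "(\<exists>y. newton h x = Some y) \<longleftrightarrow>
      partial_twice_differentiable_at h x \<and> invertible (hessian (the \<circ> h) x)"
    by (simp add: newton_def)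
  then show ?thesis
    using invertible_hessian_iff unfolding partial_twice_differentiable_at_def by blast
qed

text \<open>Under \<open>L\<close> the second derivative becomes \<open>D\<^sup>2h(L u)(L v)\<close> and the first \<open>Dh(L v)\<close>, so the equation for
the Newton step is transported by \<open>L\<close>, although the gradient and the Hessian matrix are not.\<close>

lemma newton_linear_change:
  fixes L :: "real^'n \<Rightarrow> real^'n"
  assumes y: "newton h 0 = Some y" and L: "linear L"
    and inv: "\<And>v. L (L' v) = v" "\<And>u. L' (L u) = u"
  shows "newton (h \<circ> L) 0 = Some (L' y)"
proof -
  define g where "g = the \<circ> h"
  have L0: "L 0 = 0" using L by (rule linear_0)
  have bL: "bounded_linear L" using L by (simp add: linear_conv_bounded_linear)
  from y have h: "partial_twice_differentiable_at h 0"
    and inj: "\<And>u. fderiv (fderiv g) 0 u = 0 \<Longrightarrow> u = 0"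
    and step: "fderiv (fderiv g) 0 y = - fderiv g 0"
    by (auto simp: newton_eq_Some_iff g_def)
  have g: "twice_differentiable_at g (L 0)"
    using h by (simp add: partial_twice_differentiable_at_def g_def L0)
  note lin = twice_differentiable_at_linear[OF bL]
  note comp = twice_differentiable_at_compose[OF lin(1)[of 0] g]
  have gL: "the \<circ> (h \<circ> L) = g \<circ> L" by (simp add: g_def o_assoc)
  have "\<forall>\<^sub>F v in nhds 0. L v \<in> dom h"
    using h eventually_nhds_continuous[OF linear_continuous_at[OF bL, of 0], of "\<lambda>v. v \<in> dom h"]
    by (simp add: partial_twice_differentiable_at_def L0)
  then have "partial_twice_differentiable_at (h \<circ> L) 0"
    unfolding partial_twice_differentiable_at_def gL using comp(1)
    by (auto elim!: eventually_mono)
  moreover have "u = 0" if "fderiv (fderiv (g \<circ> L)) 0 u = 0" for u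
  proof -
    have "fderiv (fderiv g) 0 (L u) v = 0" for v
      using arg_cong[OF that, of "\<lambda>T. blinfun_apply T (L' v)"] comp(3)[where u = u and v = "L' v"] by (simp add: lin L0 inv)
    then have "L u = 0" by (intro inj blinfun_eqI) simp
    then show "u = 0" using inv(2)[of u] inv(2)[of 0] L0 by simp
  qed
  moreover have "fderiv (fderiv (g \<circ> L)) 0 (L' y) = - fderiv (g \<circ> L) 0"
    using step by (intro blinfun_eqI) (simp add: comp(2,3) lin L0 inv blinfun.bilinear_simps)
  ultimately show ?thesis by (simp add: newton_eq_Some_iff gL)
qed

section \<open>Locally bounded second derivatives\<close>

text \<open>A weakening of \<open>C2_on\<close> at a point that still yields quadratic Taylor estimates and whose closure
under composition follows from norm estimates alone.\<close>

definition second_derivative_bounded_near ::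
    "('a::real_normed_vector \<Rightarrow> 'b::real_normed_vector) \<Rightarrow> 'a \<Rightarrow> bool" where
  "second_derivative_bounded_near F x \<longleftrightarrow>
     (\<exists>B. \<forall>\<^sub>F y in nhds x. twice_differentiable_at F y \<and> norm (fderiv (fderiv F) y) \<le> B)"

lemma second_derivative_bounded_near_cong:
  assumes "\<forall>\<^sub>F y in nhds x. F y = G y"
  shows "second_derivative_bounded_near F x \<longleftrightarrow> second_derivative_bounded_near G x"
proof -
  have "\<forall>\<^sub>F y in nhds x. \<forall>\<^sub>F z in nhds y. F z = G z"
    using assms by (simp add: eventually_eventually)
  then have *: "\<forall>\<^sub>F y in nhds x. (twice_differentiable_at F y \<and> norm (fderiv (fderiv F) y) \<le> B) \<longleftrightarrow>
      (twice_differentiable_at G y \<and> norm (fderiv (fderiv G) y) \<le> B)" for B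
    by eventually_elim (simp add: twice_differentiable_at_cong fderiv2_cong_nhds)
  show ?thesis
    unfolding second_derivative_bounded_near_def by (intro ex_cong1 eventually_cong[OF *]) simp
qed

lemma C2_on_imp_second_derivative_bounded_near:
  assumes "C2_on F S" "x \<in> S"
  shows "second_derivative_bounded_near F x"
proof -
  have "open S" using assms by (simp add: C2_on_def)
  have "isCont (fderiv (fderiv F)) x"
    using assms by (simp add: C2_on_def continuous_on_eq_continuous_at[OF \<open>open S\<close>])
  then have "((\<lambda>y. norm (fderiv (fderiv F) y)) \<longlongrightarrow> norm (fderiv (fderiv F) x)) (nhds x)"
    unfolding continuous_at tendsto_at_iff_tendsto_nhds by (rule tendsto_norm)
  then have "\<forall>\<^sub>F y in nhds x. norm (fderiv (fderiv F) y) < norm (fderiv (fderiv F) x) + 1"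
    by (rule order_tendstoD(2)) simp
  moreover have "\<forall>\<^sub>F y in nhds x. y \<in> S" using assms \<open>open S\<close> by (simp add: eventually_nhds_in_open)
  ultimately have "\<forall>\<^sub>F y in nhds x. twice_differentiable_at F y \<and>
      norm (fderiv (fderiv F) y) \<le> norm (fderiv (fderiv F) x) + 1"
    by eventually_elim (use assms in \<open>auto simp: C2_on_def\<close>)
  then show ?thesis unfolding second_derivative_bounded_near_def by blast
qed

lemma second_derivative_bounded_near_imp_twice_differentiable:
  "second_derivative_bounded_near F x \<Longrightarrow> twice_differentiable_at F x"
proof -
  assume "second_derivative_bounded_near F x"
  then obtain B where "\<forall>\<^sub>F y in nhds x. twice_differentiable_at F y \<and> norm (fderiv (fderiv F) y) \<le> B"
    unfolding second_derivative_bounded_near_def ..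
  from eventually_nhds_x_imp_x[OF this] show ?thesis ..
qed

text \<open>Everything follows from the mean value inequality on a ball: first for \<open>fderiv F\<close>, then for \<open>F\<close>, and
for the last bound for \<open>w \<mapsto> fderiv F y w - F w\<close> on the segment from \<open>x\<close> to \<open>y\<close>. The last bound is a
Taylor estimate with the derivative taken at the moving end point \<open>y\<close>, as the Newton defect
requires.\<close>

lemma second_derivative_bounded_near_estimates:
  fixes F :: "'a::real_normed_vector \<Rightarrow> 'b::real_normed_vector"
  assumes "second_derivative_bounded_near F x"
  obtains K where "K \<ge> 0" and
    "\<forall>\<^sub>F y in nhds x. twice_differentiable_at F y \<and> norm (fderiv (fderiv F) y) \<le> K \<and>
       norm (fderiv F y) \<le> K \<and> norm (fderiv F y - fderiv F x) \<le> K * norm (y - x) \<and>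
       norm (F y - F x) \<le> K * norm (y - x) \<and>
       norm (fderiv F y (y - x) - (F y - F x)) \<le> K * (norm (y - x))\<^sup>2"
proof -
  obtain B e where "e > 0"
    and near: "\<And>y. y \<in> ball x e \<Longrightarrow> twice_differentiable_at F y"
      "\<And>y. y \<in> ball x e \<Longrightarrow> norm (fderiv (fderiv F) y) \<le> B"
    using assms unfolding second_derivative_bounded_near_def eventually_nhds_metric
    by (auto simp: dist_commute)
  have "B \<ge> 0" using near(2)[of x] \<open>e > 0\<close> norm_ge_zero[of "fderiv (fderiv F) x"] by (simp del: norm_ge_zero)
  have x: "x \<in> ball x e" using \<open>e > 0\<close> by simp
  have lip: "norm (fderiv F y - fderiv F z) \<le> B * norm (y - z)" if "y \<in> ball x e" "z \<in> ball x e" for y z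
  proof (rule differentiable_bound[OF convex_ball _ _ that])
    fix w assume w: "w \<in> ball x e"
    show "(fderiv F has_derivative fderiv (fderiv F) w) (at w within ball x e)"
      by (rule has_derivative_at_withinI[OF twice_differentiable_at_has_derivative(2)[OF near(1)[OF w]]])
    show "onorm (fderiv (fderiv F) w) \<le> B" using near(2)[OF w] by (simp add: norm_blinfun.rep_eq)
  qed
  define K where "K = B + B * e + norm (fderiv F x)"
  have K: "B \<le> K" "B * e + norm (fderiv F x) \<le> K" using \<open>B \<ge> 0\<close> \<open>e > 0\<close> by (auto simp: K_def)
  have bd: "norm (fderiv F y) \<le> K" if "y \<in> ball x e" for y
  proof -
    have "norm (fderiv F y) \<le> norm (fderiv F y - fderiv F x) + norm (fderiv F x)"
      using norm_triangle_sub[of "fderiv F y" "fderiv F x"] by (simp add: add.commute)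
    also have "norm (fderiv F y - fderiv F x) \<le> B * norm (y - x)" by (rule lip[OF that x])
    also have "\<dots> \<le> B * e"
      using that \<open>B \<ge> 0\<close> by (intro mult_left_mono) (auto simp: dist_norm norm_minus_commute)
    finally show ?thesis using K by linarith
  qed
  have lipF: "norm (F y - F z) \<le> K * norm (y - z)" if "y \<in> ball x e" "z \<in> ball x e" for y z
  proof (rule differentiable_bound[OF convex_ball _ _ that])
    fix w assume w: "w \<in> ball x e"
    show "(F has_derivative fderiv F w) (at w within ball x e)"
      by (rule has_derivative_at_withinI[OF twice_differentiable_at_has_derivative(1)[OF near(1)[OF w]]])
    show "onorm (fderiv F w) \<le> K" using bd[OF w] by (simp add: norm_blinfun.rep_eq)
  qed
  have taylor: "norm (fderiv F y (y - x) - (F y - F x)) \<le> K * (norm (y - x))\<^sup>2" if y: "y \<in> ball x e" for y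
  proof -
    define G where "G = (\<lambda>w. fderiv F y w - F w)"
    have sub: "closed_segment x y \<subseteq> ball x e" using x y by (simp add: closed_segment_subset)
    have "norm (G y - G x) \<le> (B * norm (y - x)) * norm (y - x)"
    proof (rule differentiable_bound[OF convex_closed_segment])
      fix w assume w: "w \<in> closed_segment x y"
      then have wb: "w \<in> ball x e" using sub by blast
      show "(G has_derivative (fderiv F y - fderiv F w)) (at w within closed_segment x y)"
        unfolding G_def
        by (rule has_derivative_eq_rhs[OF has_derivative_diff[OF
              bounded_linear_imp_has_derivative[OF blinfun.bounded_linear_right]
              has_derivative_at_withinI[OF twice_differentiable_at_has_derivative(1)[OF near(1)[OF wb]]]]])
          (simp add: blinfun.bilinear_simps fun_eq_iff)
      have "norm (fderiv F y - fderiv F w) \<le> B * norm (y - w)" by (rule lip[OF y wb])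
      also have "\<dots> \<le> B * norm (y - x)"
        using segment_bound(2)[OF w] \<open>B \<ge> 0\<close> by (intro mult_left_mono) (simp_all add: norm_minus_commute)
      finally show "onorm (fderiv F y - fderiv F w) \<le> B * norm (y - x)" by (simp add: norm_blinfun.rep_eq)
    qed auto
    also have "\<dots> \<le> K * (norm (y - x))\<^sup>2"
      using K by (simp add: power2_eq_square mult.assoc mult_right_mono)
    finally show ?thesis by (simp add: G_def blinfun.bilinear_simps algebra_simps)
  qed
  show thesis
  proof
    show "K \<ge> 0" using \<open>B \<ge> 0\<close> K by simp
    have "\<forall>\<^sub>F y in nhds x. y \<in> ball x e" using \<open>e > 0\<close> by (intro eventually_nhds_in_open) auto
    then show "\<forall>\<^sub>F y in nhds x. twice_differentiable_at F y \<and> norm (fderiv (fderiv F) y) \<le> K \<and>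
       norm (fderiv F y) \<le> K \<and> norm (fderiv F y - fderiv F x) \<le> K * norm (y - x) \<and>
       norm (F y - F x) \<le> K * norm (y - x) \<and>
       norm (fderiv F y (y - x) - (F y - F x)) \<le> K * (norm (y - x))\<^sup>2"
    proof eventually_elim
      case (elim y)
      have "B * norm (y - x) \<le> K * norm (y - x)" using K by (simp add: mult_right_mono)
      then show ?case
        using near[OF elim] bd[OF elim] lip[OF elim x] lipF[OF elim x] taylor[OF elim] K by auto
    qed
  qed
qed

lemma second_derivative_bounded_near_compose:
  assumes F: "second_derivative_bounded_near F x" and g: "second_derivative_bounded_near g (F x)"
  shows "second_derivative_bounded_near (g \<circ> F) x"
proof -
  obtain K where K: "K \<ge> 0" and evF: "\<forall>\<^sub>F y in nhds x. twice_differentiable_at F y \<and>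
      norm (fderiv (fderiv F) y) \<le> K \<and> norm (fderiv F y) \<le> K"
    by (rule second_derivative_bounded_near_estimates[OF F]) (simp add: eventually_conj_iff)
  obtain M where M: "M \<ge> 0" and evg: "\<forall>\<^sub>F z in nhds (F x). twice_differentiable_at g z \<and>
      norm (fderiv (fderiv g) z) \<le> M \<and> norm (fderiv g z) \<le> M"
    by (rule second_derivative_bounded_near_estimates[OF g]) (simp add: eventually_conj_iff)
  have "isCont F x"
    using second_derivative_bounded_near_imp_twice_differentiable[OF F]
      twice_differentiable_at_imp_differentiable differentiable_imp_continuous_within by blast
  from eventually_nhds_continuous[OF this evg] evF
  have "\<forall>\<^sub>F y in nhds x. twice_differentiable_at (g \<circ> F) y \<and>
      norm (fderiv (fderiv (g \<circ> F)) y) \<le> M * K * K + M * K"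
  proof eventually_elim
    case (elim y)
    then have F: "twice_differentiable_at F y" and g: "twice_differentiable_at g (F y)" by auto
    note comp = twice_differentiable_at_compose[OF F g]
    have "norm (fderiv (fderiv (g \<circ> F)) y u v) \<le> (M * K * K + M * K) * norm u * norm v" for u v
    proof -
      have DF: "norm (fderiv F y w) \<le> K * norm w" for w
        using elim by (intro norm_blinfun_apply1) simp
      have "norm (fderiv (fderiv g) (F y) (fderiv F y u) (fderiv F y v))
          \<le> M * norm (fderiv F y u) * norm (fderiv F y v)"
        using elim by (intro norm_blinfun_apply2) simp
      also have "\<dots> \<le> M * (K * norm u) * (K * norm v)"
        using DF[of u] DF[of v] K M by (intro mult_mono) auto
      finally have 1: "norm (fderiv (fderiv g) (F y) (fderiv F y u) (fderiv F y v)) \<le> M * K * K * norm u * norm v"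
        by (simp add: mult_ac)
      have "norm (fderiv g (F y) (fderiv (fderiv F) y u v)) \<le> M * norm (fderiv (fderiv F) y u v)"
        using elim by (intro norm_blinfun_apply1) simp
      also have "\<dots> \<le> M * (K * norm u * norm v)"
        using elim M by (intro mult_left_mono norm_blinfun_apply2) simp_all
      finally show ?thesis
        unfolding comp(3) using 1 by (intro norm_triangle_le) (simp add: algebra_simps)
    qed
    then have "norm (fderiv (fderiv (g \<circ> F)) y) \<le> M * K * K + M * K"
      using K M by (intro norm_blinfun_bound) (auto intro!: add_nonneg_nonneg mult_nonneg_nonneg)
    then show ?case using comp(1) by simp
  qed
  then show ?thesis unfolding second_derivative_bounded_near_def by blast
qed

section \<open>Local quadratic estimates\<close>

text \<open>The function \<open>k(t) = Dg(t x) - t D\<^sup>2g(0) x\<close> vanishes at \<open>t = 0\<close>, and its derivative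
\<open>(D\<^sup>2g(t x) - D\<^sup>2g(0)) x\<close> is at most \<open>\<eta> |x|\<^sup>2\<close> by the hypothesis at the point \<open>t x\<close>. So \<open>Dg(x)\<close>
differs from \<open>D\<^sup>2g(0) x\<close> by at most \<open>\<eta> |x|\<^sup>2\<close>, and so does \<open>D\<^sup>2g(x) x\<close>, by the hypothesis at \<open>x\<close>.\<close>

lemma hessian_condition_imp_newton_defect:
  fixes g :: "real^'n \<Rightarrow> real"
  assumes g: "\<forall>x\<in>S. twice_differentiable_at g x" and "open S" and "0 \<in> S"
    and crit: "fderiv g 0 = 0"
    and hess: "\<And>x. x \<in> S \<Longrightarrow> norm ((hessian g x - hessian g 0) *v x) \<le> \<eta> * (norm x)\<^sup>2"
  shows "\<forall>\<^sub>F x in nhds 0. norm (fderiv (fderiv g) x x - fderiv g x) \<le> 2 * \<eta> * (norm x)\<^sup>2"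
proof -
  define T where "T = fderiv (fderiv g)"
  obtain e where "e > 0" and e: "ball 0 e \<subseteq> S"
    using assms(2,3) open_contains_ball by blast
  have T: "norm ((T x - T 0) x) \<le> \<eta> * (norm x)\<^sup>2" if "x \<in> S" for x
  proof (rule norm_blinfun_bound)
    show "\<eta> * (norm x)\<^sup>2 \<ge> 0" using hess[OF that] norm_ge_zero order_trans by blast
    fix v
    have "(T x - T 0) x v = ((hessian g x - hessian g 0) *v x) \<bullet> v"
      using g that \<open>0 \<in> S\<close>
      by (simp add: T_def blinfun.bilinear_simps matrix_vector_mult_diff_rdistrib inner_diff_left inner_hessian)
    then have "norm ((T x - T 0) x v) \<le> norm ((hessian g x - hessian g 0) *v x) * norm v"
      by (simp add: Cauchy_Schwarz_ineq2)
    also have "\<dots> \<le> \<eta> * (norm x)\<^sup>2 * norm v" by (intro mult_right_mono hess that) simp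
    finally show "norm ((T x - T 0) x v) \<le> \<eta> * (norm x)\<^sup>2 * norm v" .
  qed
  have "norm (T x x - fderiv g x) \<le> 2 * \<eta> * (norm x)\<^sup>2" if x: "x \<in> ball 0 e" for x
  proof -
    have xS: "x \<in> S" using x e by blast
    have seg: "t *\<^sub>R x \<in> S" if "t \<in> {0..1}" for t
    proof -
      have "norm (t *\<^sub>R x) \<le> norm x" using that by (simp add: mult_left_le_one_le)
      then show ?thesis using x e by auto
    qed
    define k where "k = (\<lambda>t::real. fderiv g (t *\<^sub>R x) - t *\<^sub>R T 0 x)"
    have "norm (k 1 - k 0) \<le> (\<eta> * (norm x)\<^sup>2) * norm (1 - 0 :: real)"
    proof (rule differentiable_bound[where S = "{0..1}" and f' = "\<lambda>t h. h *\<^sub>R (T (t *\<^sub>R x) - T 0) x"])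
      fix t :: real assume t: "t \<in> {0..1}"
      have 1: "((\<lambda>t. fderiv g (t *\<^sub>R x)) has_derivative (\<lambda>h. T (t *\<^sub>R x) (h *\<^sub>R x))) (at t within {0..1})"
      proof (rule has_derivative_compose[where f="\<lambda>t. t *\<^sub>R x"])
        show "(fderiv g has_derivative blinfun_apply (T (t *\<^sub>R x))) (at (t *\<^sub>R x))"
          unfolding T_def using g seg[OF t] by (intro twice_differentiable_at_has_derivative(2)) blast
      qed (auto intro!: derivative_eq_intros)
      show "(k has_derivative (\<lambda>h. h *\<^sub>R (T (t *\<^sub>R x) - T 0) x)) (at t within {0..1})"
        unfolding k_def
        by (rule has_derivative_eq_rhs[OF has_derivative_diff[OF 1
              has_derivative_scaleR_left[OF has_derivative_ident]]])
          (simp add: blinfun.bilinear_simps scaleR_diff_right)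
      have "norm ((T (t *\<^sub>R x) - T 0) x) \<le> \<eta> * (norm x)\<^sup>2"
      \<comment> \<open>the hypothesis at \<open>t x\<close> bounds \<open>t\<close> times the norm, which says nothing for \<open>t = 0\<close>\<close>
      proof (cases "t = 0")
        case True
        then show ?thesis using order_trans[OF norm_ge_zero hess[OF xS]] by simp
      next
        case False
        then have "t > 0" using t by simp
        have "t * norm ((T (t *\<^sub>R x) - T 0) x) = norm ((T (t *\<^sub>R x) - T 0) (t *\<^sub>R x))"
          using \<open>t > 0\<close> by (simp add: blinfun.scaleR_right)
        also have "\<dots> \<le> \<eta> * (norm (t *\<^sub>R x))\<^sup>2" by (intro T seg t)
        also have "\<dots> = t * (t * (\<eta> * (norm x)\<^sup>2))"
          by (simp add: power_mult_distrib power2_eq_square mult_ac)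
        finally have "norm ((T (t *\<^sub>R x) - T 0) x) \<le> t * (\<eta> * (norm x)\<^sup>2)"
          using \<open>t > 0\<close> by simp
        also have "\<dots> \<le> \<eta> * (norm x)\<^sup>2"
          using t order_trans[OF norm_ge_zero hess[OF xS]] by (intro mult_left_le_one_le) auto
        finally show ?thesis .
      qed
      then show "onorm (\<lambda>h. h *\<^sub>R (T (t *\<^sub>R x) - T 0) x) \<le> \<eta> * (norm x)\<^sup>2"
        by (intro onorm_le) (simp add: mult.commute mult_left_mono)
    qed auto
    then have "norm (fderiv g x - T 0 x) \<le> \<eta> * (norm x)\<^sup>2"
      by (simp add: k_def crit)
    moreover have eq: "T x x - fderiv g x = (T x - T 0) x - (fderiv g x - T 0 x)"
      by (simp add: blinfun.bilinear_simps)
    ultimately show ?thesis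
      unfolding eq using T[OF xS] norm_triangle_ineq4[of "(T x - T 0) x" "fderiv g x - T 0 x"] by linarith
  qed
  moreover have "\<forall>\<^sub>F x :: real^'n in nhds 0. x \<in> ball 0 e"
    using \<open>e > 0\<close> by (intro eventually_nhds_in_open) auto
  ultimately show ?thesis
    unfolding T_def by (simp add: eventually_mono)
qed

text \<open>With \<open>z = \<tau>(x)\<close> and \<open>w = D\<tau>(x) v\<close>, the chain rule splits the new defect at \<open>(x, v)\<close> into
\<open>D\<^sup>2g(z)(D\<tau>(x) x - z, w)\<close>, which is small by Taylor's estimate for \<open>\<tau>\<close>, the old defect at \<open>z\<close>
applied to \<open>w\<close>, and \<open>Dg(z)(D\<^sup>2\<tau>(x)(x, v))\<close>, in which both \<open>Dg(z)\<close> and \<open>x\<close> are small.\<close>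

lemma newton_defect_compose:
  fixes g :: "'b::real_normed_vector \<Rightarrow> real" and \<tau> :: "'a::real_normed_vector \<Rightarrow> 'b"
  assumes \<tau>: "second_derivative_bounded_near \<tau> 0" and "\<tau> 0 = 0"
    and g: "second_derivative_bounded_near g 0" and crit: "fderiv g 0 = 0"
    and defect: "\<forall>\<^sub>F z in nhds 0. norm (fderiv (fderiv g) z z - fderiv g z) \<le> C * (norm z)\<^sup>2"
    and "C \<ge> 0"
  shows "\<exists>C'. \<forall>\<^sub>F x in nhds 0.
    norm (fderiv (fderiv (g \<circ> \<tau>)) x x - fderiv (g \<circ> \<tau>) x) \<le> C' * (norm x)\<^sup>2"
proof -
  obtain K where K: "K \<ge> 0" and ev\<tau>: "\<forall>\<^sub>F x in nhds 0. twice_differentiable_at \<tau> x \<and>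
      norm (fderiv (fderiv \<tau>) x) \<le> K \<and> norm (fderiv \<tau> x) \<le> K \<and> norm (\<tau> x) \<le> K * norm x \<and>
      norm (fderiv \<tau> x x - \<tau> x) \<le> K * (norm x)\<^sup>2"
    by (rule second_derivative_bounded_near_estimates[OF \<tau>]) (simp add: eventually_conj_iff \<open>\<tau> 0 = 0\<close>)
  obtain M where M: "M \<ge> 0" and evg: "\<forall>\<^sub>F z in nhds 0. twice_differentiable_at g z \<and>
      norm (fderiv (fderiv g) z) \<le> M \<and> norm (fderiv g z) \<le> M * norm z"
    by (rule second_derivative_bounded_near_estimates[OF g]) (simp add: eventually_conj_iff crit)
  have "isCont \<tau> 0"
    using second_derivative_bounded_near_imp_twice_differentiable[OF \<tau>]
      twice_differentiable_at_imp_differentiable differentiable_imp_continuous_within by blast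
  then have ev: "\<forall>\<^sub>F x in nhds 0. (twice_differentiable_at g (\<tau> x) \<and>
      norm (fderiv (fderiv g) (\<tau> x)) \<le> M \<and> norm (fderiv g (\<tau> x)) \<le> M * norm (\<tau> x)) \<and>
      norm (fderiv (fderiv g) (\<tau> x) (\<tau> x) - fderiv g (\<tau> x)) \<le> C * (norm (\<tau> x))\<^sup>2"
    using eventually_nhds_continuous[of 0 \<tau>, unfolded \<open>\<tau> 0 = 0\<close>, OF _ eventually_conj[OF evg defect]]
    by blast
  \<comment> \<open>one summand for each of the three terms, in this order\<close>
  define C' where "C' = M * K * K + C * K * K * K + M * K * K"
  from ev ev\<tau> have "\<forall>\<^sub>F x in nhds 0.
    norm (fderiv (fderiv (g \<circ> \<tau>)) x x - fderiv (g \<circ> \<tau>) x) \<le> C' * (norm x)\<^sup>2"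
  proof eventually_elim
    case (elim x)
    define z where "z = \<tau> x"
    define N where "N = norm x"
    have N: "N \<ge> 0" by (simp add: N_def)
    from elim have dg: "twice_differentiable_at g z" "norm (fderiv (fderiv g) z) \<le> M"
        "norm (fderiv g z) \<le> M * norm z" "norm (fderiv (fderiv g) z z - fderiv g z) \<le> C * (norm z)\<^sup>2"
      and d\<tau>: "twice_differentiable_at \<tau> x" "norm (fderiv (fderiv \<tau>) x) \<le> K" "norm (fderiv \<tau> x) \<le> K"
        "norm z \<le> K * N" "norm (fderiv \<tau> x x - z) \<le> K * N\<^sup>2"
      by (auto simp: z_def N_def)
    note comp = twice_differentiable_at_compose[OF d\<tau>(1) dg(1)[unfolded z_def], folded z_def]
    show ?case
    proof (rule norm_blinfun_bound)
      show "0 \<le> C' * (norm x)\<^sup>2" using K M \<open>C \<ge> 0\<close> by (auto simp: C'_def intro!: mult_nonneg_nonneg add_nonneg_nonneg)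
      fix v
      define w where "w = fderiv \<tau> x v"
      have w: "norm w \<le> K * norm v" unfolding w_def by (rule norm_blinfun_apply1[OF d\<tau>(3)])
      have eq: "(fderiv (fderiv (g \<circ> \<tau>)) x x - fderiv (g \<circ> \<tau>) x) v =
          fderiv (fderiv g) z (fderiv \<tau> x x - z) w + (fderiv (fderiv g) z z - fderiv g z) w
          + fderiv g z (fderiv (fderiv \<tau>) x x v)"
        by (simp add: comp(2,3) w_def blinfun.bilinear_simps)
      have "norm (fderiv (fderiv g) z (fderiv \<tau> x x - z) w) \<le> M * norm (fderiv \<tau> x x - z) * norm w"
        by (rule norm_blinfun_apply2[OF dg(2)])
      also have "\<dots> \<le> M * (K * N\<^sup>2) * (K * norm v)"
        using M K N d\<tau>(5) w by (intro mult_mono) auto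
      finally have 1: "norm (fderiv (fderiv g) z (fderiv \<tau> x x - z) w) \<le> M * (K * N\<^sup>2) * (K * norm v)" .
      have "norm ((fderiv (fderiv g) z z - fderiv g z) w) \<le> C * (norm z)\<^sup>2 * norm w"
        by (rule norm_blinfun_apply1[OF dg(4)])
      also have "\<dots> \<le> C * (K * N)\<^sup>2 * (K * norm v)"
        using M K N d\<tau>(4) w \<open>C \<ge> 0\<close> by (intro mult_mono power_mono) auto
      finally have 2: "norm ((fderiv (fderiv g) z z - fderiv g z) w) \<le> C * (K * N)\<^sup>2 * (K * norm v)" .
      have "norm (fderiv g z (fderiv (fderiv \<tau>) x x v)) \<le> M * norm z * norm (fderiv (fderiv \<tau>) x x v)"
        by (rule norm_blinfun_apply1[OF dg(3)])
      also have "\<dots> \<le> M * (K * N) * (K * N * norm v)"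
        using M K N d\<tau>(4) norm_blinfun_apply2[OF d\<tau>(2), of x v]
        by (intro mult_mono) (auto simp: N_def)
      finally have 3: "norm (fderiv g z (fderiv (fderiv \<tau>) x x v)) \<le> M * (K * N) * (K * N * norm v)" .
      have "norm ((fderiv (fderiv (g \<circ> \<tau>)) x x - fderiv (g \<circ> \<tau>) x) v) \<le>
          M * (K * N\<^sup>2) * (K * norm v) + C * (K * N)\<^sup>2 * (K * norm v) + M * (K * N) * (K * N * norm v)"
        unfolding eq by (intro norm_triangle_le add_mono 1 2 3)
      also have "\<dots> = C' * (norm x)\<^sup>2 * norm v"
        by (simp add: C'_def N_def power2_eq_square algebra_simps)
      finally show "norm ((fderiv (fderiv (g \<circ> \<tau>)) x x - fderiv (g \<circ> \<tau>) x) v) \<le> C' * (norm x)\<^sup>2 * norm v" .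
    qed
  qed
  then show ?thesis by blast
qed

text \<open>An injective matrix is bounded below, and testing \<open>D\<^sup>2g(x) u\<close> on the vector \<open>w\<close> that represents it
shows that the norm of the functional is at least the norm of the vector.\<close>

lemma injective_second_derivative_bounded_below:
  fixes g :: "real^'n \<Rightarrow> real"
  assumes g: "twice_differentiable_at g x" and inj: "\<And>u. fderiv (fderiv g) x u = 0 \<Longrightarrow> u = 0"
  obtains m where "m > 0" "\<And>u. m * norm u \<le> norm (fderiv (fderiv g) x u)"
proof -
  have "inj ((*v) (hessian g x))"
    using inj hessian_mult_eq_0_iff[OF g] by (simp add: linear_injective_0)
  then obtain m where m: "m > 0" "\<And>u. m * norm u \<le> norm (hessian g x *v u)"
    using linear_inj_bounded_below_pos[OF matrix_vector_mul_linear] by metis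
  have "norm (hessian g x *v u) \<le> norm (fderiv (fderiv g) x u)" for u
  proof -
    define w where "w = hessian g x *v u"
    have "norm w * norm w = fderiv (fderiv g) x u w"
      using inner_hessian[OF g, of u w] by (simp add: w_def flip: power2_norm_eq_inner power2_eq_square)
    also have "\<dots> \<le> norm (fderiv (fderiv g) x u) * norm w"
      using norm_blinfun[of "fderiv (fderiv g) x u" w] by simp
    finally show ?thesis unfolding w_def[symmetric] by (cases "w = 0") auto
  qed
  then show thesis using that[of m] m order_trans by blast
qed

text \<open>The quadratic estimate for one Newton step. The constant and the neighbourhood are chosen before
the map \<open>F\<close>, of which only \<open>F 0\<close>, \<open>DF(0)\<close> and a bound for \<open>D\<^sup>2F(0)\<close> matter; this is the source of the
uniformity over all choices of parametrisations.\<close>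

lemma newton_step_estimate:
  fixes g :: "real^'n \<Rightarrow> real"
  assumes twice: "\<forall>\<^sub>F x in nhds 0. twice_differentiable_at g x"
    and cont: "isCont (fderiv (fderiv g)) 0"
    and crit: "fderiv g 0 = 0"
    and inj: "\<And>u. fderiv (fderiv g) 0 u = 0 \<Longrightarrow> u = 0"
    and defect: "\<forall>\<^sub>F x in nhds 0. norm (fderiv (fderiv g) x x - fderiv g x) \<le> C * (norm x)\<^sup>2"
    and "\<alpha> \<ge> 0"
  shows "\<exists>K. \<forall>\<^sub>F x in nhds 0. \<forall>F h. twice_differentiable_at F 0 \<longrightarrow> F 0 = x \<longrightarrow>
    (\<forall>u. fderiv F 0 u = u) \<longrightarrow>
    (\<forall>u v. norm (fderiv (fderiv F) 0 u v) \<le> \<alpha> * norm u * norm v) \<longrightarrow>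
    (\<forall>\<^sub>F y in nhds 0. h y = Some (g (F y))) \<longrightarrow>
    (\<exists>y. newton h 0 = Some y \<and> norm y \<le> K * norm x \<and> norm (x + y) \<le> K * (norm x)\<^sup>2)"
proof -
  define T where "T = fderiv (fderiv g)"
  have g0: "twice_differentiable_at g 0" using eventually_nhds_x_imp_x[OF twice] .
  obtain m where m: "m > 0" "\<And>u. m * norm u \<le> norm (T 0 u)"
    using injective_second_derivative_bounded_below[OF g0 inj] unfolding T_def by blast
  have tT: "(T \<longlongrightarrow> T 0) (nhds 0)"
    using cont by (simp add: T_def continuous_at tendsto_at_iff_tendsto_nhds)
  have "isCont (fderiv g) 0"
    using g0 differentiable_imp_continuous_within by (auto simp: twice_differentiable_at_def)
  then have tD: "(fderiv g \<longlongrightarrow> 0) (nhds 0)"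
    using crit tendsto_at_iff_tendsto_nhds[of "fderiv g" 0] by (simp add: continuous_at)
  have "second_derivative_bounded_near g 0"
  proof -
    have "\<forall>\<^sub>F x in nhds 0. norm (T x) < norm (T 0) + 1"
      by (rule order_tendstoD(2)[OF tendsto_norm[OF tT]]) simp
    with twice have "\<forall>\<^sub>F x in nhds 0. twice_differentiable_at g x \<and> norm (T x) \<le> norm (T 0) + 1"
      by eventually_elim simp
    then show ?thesis unfolding second_derivative_bounded_near_def T_def by blast
  qed
  then obtain M where M: "M \<ge> 0" and evM: "\<forall>\<^sub>F x in nhds 0. norm (fderiv g x) \<le> M * norm x"
    by (rule second_derivative_bounded_near_estimates) (simp add: eventually_conj_iff crit)
  \<comment> \<open>\<open>2 / m\<close> bounds the inverse of the perturbed form, the other factor the residual at \<open>x + y\<close>\<close>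
  define K0 where "K0 = 2 * (\<bar>C\<bar> + M * \<alpha>) / m"
  have K0: "K0 \<ge> 0" using m(1) M \<open>\<alpha> \<ge> 0\<close> by (simp add: K0_def)
  have "\<forall>\<^sub>F x in nhds 0. norm (T x - T 0) < m / 4"
    using tendstoD[OF tT, of "m / 4"] m(1) by (simp add: dist_norm)
  moreover have "((\<lambda>x. norm (fderiv g x) * \<alpha>) \<longlongrightarrow> 0) (nhds 0)"
    using tendsto_mult_left_zero[OF tendsto_norm_zero[OF tD]] .
  then have "\<forall>\<^sub>F x in nhds 0. norm (fderiv g x) * \<alpha> < m / 4"
    using m(1) by (intro order_tendstoD) auto
  moreover have "\<forall>\<^sub>F x::real^'n in nhds 0. norm x < 1"
    using eventually_nhds_in_open[of "ball (0::real^'n) 1" 0] by simp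
  ultimately have "\<forall>\<^sub>F x in nhds 0. \<forall>F h. twice_differentiable_at F 0 \<longrightarrow> F 0 = x \<longrightarrow>
    (\<forall>u. fderiv F 0 u = u) \<longrightarrow>
    (\<forall>u v. norm (fderiv (fderiv F) 0 u v) \<le> \<alpha> * norm u * norm v) \<longrightarrow>
    (\<forall>\<^sub>F y in nhds 0. h y = Some (g (F y))) \<longrightarrow>
    (\<exists>y. newton h 0 = Some y \<and> norm y \<le> (K0 + 1) * norm x \<and> norm (x + y) \<le> (K0 + 1) * (norm x)\<^sup>2)"
    using twice defect evM
  proof eventually_elim
    case (elim x)
    show ?case
    proof (intro allI impI)
      fix F :: "real^'n \<Rightarrow> real^'n" and h
      assume F: "twice_differentiable_at F 0" and F0: "F 0 = x" and DF: "\<forall>u. fderiv F 0 u = u"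
        and D2F: "\<forall>u v. norm (fderiv (fderiv F) 0 u v) \<le> \<alpha> * norm u * norm v"
        and h: "\<forall>\<^sub>F y in nhds 0. h y = Some (g (F y))"
      have gx: "twice_differentiable_at g (F 0)" using elim F0 by simp
      note comp = twice_differentiable_at_compose[OF F gx, unfolded F0]
      have ev: "\<forall>\<^sub>F y in nhds 0. (the \<circ> h) y = (g \<circ> F) y"
        using h by eventually_elim simp
      define B where "B = fderiv (fderiv (the \<circ> h)) 0"
      define D where "D = fderiv (the \<circ> h) 0"
      have B: "B u v = T x u v + fderiv g x (fderiv (fderiv F) 0 u v)" for u v
        unfolding B_def T_def using fderiv2_cong_nhds[of "the \<circ> h" "g \<circ> F", OF ev] comp(3) by (simp add: DF)
      have D: "D v = fderiv g x v" for v
        unfolding D_def using fderiv_cong_nhds[of "the \<circ> h" "g \<circ> F", OF ev] comp(2) by (simp add: DF)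
      have ptd: "partial_twice_differentiable_at h 0"
        unfolding partial_twice_differentiable_at_def twice_differentiable_at_cong[OF ev]
        using comp(1) h by (auto elim!: eventually_mono)
      have err: "norm (fderiv g x (fderiv (fderiv F) 0 u v)) \<le> norm (fderiv g x) * (\<alpha> * norm u * norm v)" for u v
        using norm_blinfun[of "fderiv g x" "fderiv (fderiv F) 0 u v"] D2F
        by (meson mult_left_mono norm_ge_zero order_trans)
      \<comment> \<open>each of the two perturbations of \<open>D\<^sup>2g(0)\<close> costs at most a quarter of its lower bound \<open>m\<close>\<close>
      have below: "m / 2 * norm u \<le> norm (B u)" for u
      proof -
        have "norm (B u - T 0 u) \<le> m / 2 * norm u"
        proof (rule norm_blinfun_bound)
          show "0 \<le> m / 2 * norm u" using m(1) by simp
          fix v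
          have eq: "(B u - T 0 u) v = (T x - T 0) u v + fderiv g x (fderiv (fderiv F) 0 u v)"
            by (simp add: B blinfun.bilinear_simps)
          have "norm ((T x - T 0) u v) \<le> m / 4 * norm u * norm v"
            using elim by (intro norm_blinfun_apply2) simp
          moreover have "norm (fderiv g x) * (\<alpha> * norm u * norm v) \<le> m / 4 * (norm u * norm v)"
            using elim mult_right_mono[of "norm (fderiv g x) * \<alpha>" "m / 4" "norm u * norm v"] by (simp add: mult_ac)
          ultimately show "norm ((B u - T 0 u) v) \<le> m / 2 * norm u * norm v"
            unfolding eq using err[of u v]
              norm_triangle_ineq[of "(T x - T 0) u v" "fderiv g x (fderiv (fderiv F) 0 u v)"]
            by simp
        qed
        then show ?thesis
          using m(2)[of u] norm_triangle_sub[of "T 0 u" "B u"] by (simp add: norm_minus_commute)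
      qed
      have "u = 0" if "B u = 0" for u
        using below[of u] that m(1) by (simp add: mult_le_0_iff)
      then obtain y where y: "newton h 0 = Some y"
        using newton_defined_iff[of h 0] ptd unfolding B_def by blast
      then have step: "B y = - D" by (simp add: newton_eq_Some_iff B_def D_def)
      have "norm (B (x + y)) \<le> (\<bar>C\<bar> + M * \<alpha>) * (norm x)\<^sup>2"
      proof (rule norm_blinfun_bound)
        show "0 \<le> (\<bar>C\<bar> + M * \<alpha>) * (norm x)\<^sup>2" using M \<open>\<alpha> \<ge> 0\<close> by simp
        fix v
        have eq: "B (x + y) v = (T x x - fderiv g x) v + fderiv g x (fderiv (fderiv F) 0 x v)"
          using step by (simp add: blinfun.bilinear_simps B D)
        have "norm (T x x - fderiv g x) \<le> \<bar>C\<bar> * (norm x)\<^sup>2"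
          using elim mult_right_mono[OF abs_ge_self[of C], of "(norm x)\<^sup>2"] by (simp add: T_def)
        then have "norm ((T x x - fderiv g x) v) \<le> \<bar>C\<bar> * (norm x)\<^sup>2 * norm v"
          by (rule norm_blinfun_apply1)
        moreover have "norm (fderiv g x) * (\<alpha> * norm x * norm v) \<le> M * norm x * (\<alpha> * norm x * norm v)"
          using elim \<open>\<alpha> \<ge> 0\<close> by (intro mult_right_mono) auto
        ultimately show "norm (B (x + y) v) \<le> (\<bar>C\<bar> + M * \<alpha>) * (norm x)\<^sup>2 * norm v"
          unfolding eq using err[of x v]
            norm_triangle_ineq[of "(T x x - fderiv g x) v" "fderiv g x (fderiv (fderiv F) 0 x v)"]
          by (simp add: algebra_simps power2_eq_square)
      qed
      then have "m / 2 * norm (x + y) \<le> (\<bar>C\<bar> + M * \<alpha>) * (norm x)\<^sup>2"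
        using below[of "x + y"] by linarith
      then have xy: "norm (x + y) \<le> K0 * (norm x)\<^sup>2"
        using m(1) by (simp add: K0_def field_simps)
      have "(norm x)\<^sup>2 \<le> norm x"
        using elim by (simp add: power2_eq_square mult_left_le_one_le)
      then have "K0 * (norm x)\<^sup>2 \<le> K0 * norm x" using K0 by (rule mult_left_mono)
      then have "norm y \<le> (K0 + 1) * norm x"
        using xy norm_triangle_ineq4[of "x + y" x] by (simp add: algebra_simps)
      moreover have "norm (x + y) \<le> (K0 + 1) * (norm x)\<^sup>2"
        using xy by (simp add: algebra_simps) (smt (verit) zero_le_power2)
      ultimately show "\<exists>y. newton h 0 = Some y \<and> norm y \<le> (K0 + 1) * norm x \<and> norm (x + y) \<le> (K0 + 1) * (norm x)\<^sup>2"
        using y by blast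
    qed
  qed
  then show ?thesis by blast
qed

section \<open>Charts and tangent vectors\<close>

lemma charts_atD:
  assumes "c \<in> charts_at A p"
  shows "topological_chart c" "p \<in> fst c" "c \<in> C2_charts A"
  using assms by (auto simp: charts_at_def C2_charts_def)

lemma inj_on_chart: "topological_chart c \<Longrightarrow> inj_on (snd c) (fst c)"
  unfolding topological_chart_def homeomorphism_def by (metis inj_on_inverseI)

lemma chart_inv_apply:
  assumes "topological_chart c" "p \<in> fst c"
  shows "chart_inv c (snd c p) = p"
  using assms by (simp add: chart_inv_def inj_on_chart)

lemma transition_apply:
  assumes "topological_chart c" "p \<in> fst c"
  shows "transition c d (snd c p) = snd d p"
  by (simp add: transition_def chart_inv_apply[OF assms])

lemma open_chart_image:
  assumes c: "topological_chart c" and "open S"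
  shows "open (snd c ` (fst c \<inter> S))"
proof -
  have "openin (top_of_set (snd c ` fst c)) (snd c ` (fst c \<inter> S))"
    using c \<open>open S\<close> unfolding topological_chart_def
    by (intro homeomorphism_imp_open_map[of "fst c" "snd c ` fst c" "snd c" "chart_inv c"])
      (auto simp: openin_open_Int)
  then show ?thesis
    using c openin_open_trans by (auto simp: topological_chart_def)
qed

text \<open>The existential form, with \<open>x = snd c q\<close> instead of \<open>q = chart_inv c x\<close>, lets statements about points
be carried to coordinates without mentioning the inverse.\<close>

lemma eventually_nhds_chart:
  assumes c: "topological_chart c" and p: "p \<in> fst c" and "\<forall>\<^sub>F q in nhds p. P q"
  shows "\<forall>\<^sub>F x in nhds (snd c p). \<exists>q\<in>fst c. x = snd c q \<and> P q"
proof -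
  obtain S where S: "open S" "p \<in> S" "\<And>q. q \<in> S \<Longrightarrow> P q"
    using assms(3) unfolding eventually_nhds by blast
  have "\<forall>\<^sub>F x in nhds (snd c p). x \<in> snd c ` (fst c \<inter> S)"
    using open_chart_image[OF c S(1)] p S(2) by (intro eventually_nhds_in_open) auto
  then show ?thesis by eventually_elim (use S(3) in blast)
qed

lemma eventually_nhds_fst_chart:
  assumes "topological_chart c" "p \<in> fst c"
  shows "\<forall>\<^sub>F q in nhds p. q \<in> fst c"
  using assms by (intro eventually_nhds_in_open) (auto simp: topological_chart_def)

lemma transition_compose:
  assumes "topological_chart c" "topological_chart d" "p \<in> fst c" "p \<in> fst d"
  shows "\<forall>\<^sub>F x in nhds (snd c p). transition c e x = (transition d e \<circ> transition c d) x"
  using eventually_nhds_chart[OF assms(1,3) eventually_nhds_fst_chart[OF assms(2,4)]]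
  by eventually_elim (use assms in \<open>auto simp: transition_apply\<close>)

text \<open>Charts of the maximal atlas are compatible with those of \<open>A\<close> by definition, but with each other
only after factoring the transition map through a chart of \<open>A\<close>.\<close>

lemma second_derivative_bounded_near_transition:
  assumes A: "C2_atlas A" and c: "c \<in> charts_at A p" and d: "d \<in> charts_at A p"
  shows "second_derivative_bounded_near (transition c d) (snd c p)"
proof -
  note c' = charts_atD[OF c] and d' = charts_atD[OF d]
  obtain a where a: "a \<in> A" "p \<in> fst a"
    using A unfolding C2_atlas_def by blast
  then have ta: "topological_chart a" using A by (simp add: C2_atlas_def)
  have "C2_on (transition c a) (snd c ` (fst c \<inter> fst a))" "C2_on (transition a d) (snd a ` (fst d \<inter> fst a))"
    using c' d' a by (auto simp: C2_charts_def C2_compatible_def)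
  then have "second_derivative_bounded_near (transition c a) (snd c p)"
      "second_derivative_bounded_near (transition a d) (snd a p)"
    using c' d' a by (auto intro!: C2_on_imp_second_derivative_bounded_near)
  then have "second_derivative_bounded_near (transition a d \<circ> transition c a) (snd c p)"
    using c' by (intro second_derivative_bounded_near_compose) (simp_all add: transition_apply)
  then show ?thesis
    using second_derivative_bounded_near_cong[OF transition_compose[OF c'(1) ta c'(2) a(2)]] by (simp add: o_def)
qed

abbreviation transition_derivative ::
    "('m, 'n::finite) chart \<Rightarrow> ('m, 'n) chart \<Rightarrow> 'm \<Rightarrow> real^'n \<Rightarrow> real^'n" where
  "transition_derivative c d p \<equiv> frechet_derivative (transition c d) (at (snd c p))"

lemma has_derivative_transition:
  assumes "C2_atlas A" "c \<in> charts_at A p" "d \<in> charts_at A p"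
  shows "(transition c d has_derivative transition_derivative c d p) (at (snd c p))"
  using second_derivative_bounded_near_transition[OF assms]
    second_derivative_bounded_near_imp_twice_differentiable
    twice_differentiable_at_imp_differentiable frechet_derivative_works by blast

lemma transition_derivative_compose:
  assumes A: "C2_atlas A" and c: "c \<in> charts_at A p" and d: "d \<in> charts_at A p" and e: "e \<in> charts_at A p"
  shows "transition_derivative d e p (transition_derivative c d p x) = transition_derivative c e p x"
proof -
  note c' = charts_atD[OF c] and d' = charts_atD[OF d]
  have "((transition d e \<circ> transition c d) has_derivative
      (transition_derivative d e p \<circ> transition_derivative c d p)) (at (snd c p))"
    using has_derivative_transition[OF A d e] has_derivative_transition[OF A c d] c'
    by (intro diff_chain_at) (simp_all add: transition_apply)
  then have "(transition c e has_derivative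
      (transition_derivative d e p \<circ> transition_derivative c d p)) (at (snd c p))"
    using has_derivative_cong_nhds[OF transition_compose[OF c'(1) d'(1) c'(2) d'(2)]] by (simp add: o_def)
  then show ?thesis
    using has_derivative_unique[OF _ has_derivative_transition[OF A c e]] by (metis comp_apply)
qed

lemma transition_derivative_self:
  assumes "C2_atlas A" "c \<in> charts_at A p"
  shows "transition_derivative c c p x = x"
proof -
  note c = charts_atD[OF assms(2)]
  have "\<forall>\<^sub>F x in nhds (snd c p). x = transition c c x"
    using eventually_nhds_chart[OF c(1,2), of "\<lambda>_. True"]
    by (auto simp: transition_apply[OF c(1)] elim!: eventually_mono)
  then have "(transition c c has_derivative (\<lambda>x. x)) (at (snd c p))"
    using has_derivative_cong_nhds[of "\<lambda>x. x"] by (metis has_derivative_ident)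
  then show ?thesis
    using has_derivative_unique[OF has_derivative_transition[OF assms assms(2)]] by metis
qed

text \<open>The cocycle rule for derivatives of transition maps shows that the right-hand side is a tangent
vector, and a tangent vector is determined by its component in one chart.\<close>

lemma tangent_vector_eq:
  assumes A: "C2_atlas A" and c: "c \<in> charts_at A p"
  shows "tangent_vector A p c x = (\<lambda>d. if d \<in> charts_at A p then transition_derivative c d p x else 0)"
    (is "_ = ?v")
proof -
  have "?v \<in> tangent_space A p"
    by (simp add: tangent_space_def transition_derivative_compose[OF A c])
  moreover have "?v c = x" using c by (simp add: transition_derivative_self[OF A c])
  moreover have "inj_on (\<lambda>v. v c) (tangent_space A p)"
  proof (rule inj_onI)
    fix v w assume "v \<in> tangent_space A p" "w \<in> tangent_space A p" "v c = w c"
    then have "v d = transition_derivative c d p (v c)" "w d = transition_derivative c d p (w c)"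
      if "d \<in> charts_at A p" for d
      using c that unfolding tangent_space_def by blast+
    moreover have "v d = 0" "w d = 0" if "d \<notin> charts_at A p" for d
      using \<open>v \<in> tangent_space A p\<close> \<open>w \<in> tangent_space A p\<close> that unfolding tangent_space_def by blast+
    ultimately have "v d = w d" for d
      using \<open>v c = w c\<close> by (cases "d \<in> charts_at A p") simp_all
    then show "v = w" ..
  qed
  ultimately have "inv_into (tangent_space A p) (\<lambda>v. v c) (?v c) = ?v"
    using inv_into_f_f[of "\<lambda>v. v c" "tangent_space A p" ?v] by blast
  then show ?thesis
    unfolding tangent_vector_def \<open>?v c = x\<close> .
qed

lemma tangent_vector_apply_self:
  assumes "C2_atlas A" "c \<in> charts_at A p"
  shows "tangent_vector A p c x c = x"
  using assms by (simp add: tangent_vector_eq transition_derivative_self)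

lemma tangent_vector_zero:
  assumes "C2_atlas A" "c \<in> charts_at A p"
  shows "tangent_vector A p c 0 = (\<lambda>_. 0)"
proof -
  have "transition_derivative c d p 0 = 0" if "d \<in> charts_at A p" for d
    by (rule linear_0[OF has_derivative_linear[OF has_derivative_transition[OF assms that]]])
  then show ?thesis by (simp add: tangent_vector_eq[OF assms] fun_eq_iff)
qed

lemma tangent_vector_change_chart:
  assumes "C2_atlas A" "c \<in> charts_at A p" "d \<in> charts_at A p"
  shows "tangent_vector A p d (transition_derivative c d p x) = tangent_vector A p c x"
  by (simp add: tangent_vector_eq[OF assms(1)] assms(2,3) transition_derivative_compose[OF assms] fun_eq_iff)

text \<open>The chart chosen in the definition depends on \<open>p\<close> in an uncontrolled way, so uniform estimates are
possible only after passing to one fixed chart \<open>c\<close>. The two coordinate systems on the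
tangent space differ by a linear isomorphism.\<close>

lemma tangent_newton_at_origin_eq:
  assumes A: "C2_atlas A" and c: "c \<in> charts_at A p"
    and y: "newton (h \<circ> tangent_vector A p c) 0 = Some y"
  shows "tangent_newton_at_origin A p h = Some (tangent_vector A p c y)"
proof -
  define d where "d = (SOME d. d \<in> charts_at A p)"
  have d: "d \<in> charts_at A p" unfolding d_def using c by (rule someI)
  have eq: "h \<circ> tangent_vector A p d = (h \<circ> tangent_vector A p c) \<circ> transition_derivative d c p"
    by (simp add: fun_eq_iff tangent_vector_change_chart[OF A d c])
  have "newton (h \<circ> tangent_vector A p d) 0 = Some (transition_derivative c d p y)"
    unfolding eq using y
  proof (rule newton_linear_change)
    show "linear (transition_derivative d c p)"
      using has_derivative_transition[OF A d c] has_derivative_linear by blast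
  qed (simp_all add: transition_derivative_compose[OF A] transition_derivative_self[OF A] c d)
  then show ?thesis
    unfolding tangent_newton_at_origin_def Let_def d_def[symmetric]
    by (simp add: tangent_vector_change_chart[OF A c d])
qed

lemma local_rep_eq_Some_iff:
  "local_rep A p c c h y = Some z \<longleftrightarrow>
     (\<exists>q\<in>fst c. h (tangent_vector A p c y) = Some q \<and> snd c q = z)"
  by (auto simp: local_rep_def map_comp_def chart_pmap_def split: option.splits)

text \<open>Translation of one step of the method into coordinates. The predicate \<open>Q\<close> stands for whatever is
known about the Newton step in \<open>\<real>\<^sup>n\<close>; the lemma checks that the local representative of \<open>\<phi>\<close>
satisfies the assumptions made on \<open>F\<close> there. The factor 2 in the bound on its second derivative
is the cost of polarisation.\<close>

lemma whimsical_step: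
  assumes A: "C2_atlas A" and c: "c \<in> charts_at A p"
    and E0: "E0 A p \<phi> \<psi>" and E1: "E1 A c \<alpha> p \<phi>" and E2: "E2 A c \<rho> \<beta> p \<psi>"
    and newton: "\<And>F h. twice_differentiable_at F 0 \<Longrightarrow> F 0 = snd c p \<Longrightarrow> (\<forall>u. fderiv F 0 u = u) \<Longrightarrow>
      (\<forall>u v. norm (fderiv (fderiv F) 0 u v) \<le> 2 * \<alpha> * norm u * norm v) \<Longrightarrow>
      (\<forall>\<^sub>F y in nhds 0. h y = Some ((f \<circ> chart_inv c) (F y))) \<Longrightarrow>
      \<exists>y. newton h 0 = Some y \<and> Q y"
    and small: "\<And>y. Q y \<Longrightarrow> norm y < \<rho>"
  obtains y q where "Q y" "q \<in> fst c" "norm (snd c q - snd c p - y) \<le> \<beta> * (norm y)\<^sup>2"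
    "Option.bind (tangent_newton_at_origin A p (map_option f \<circ> \<phi>)) \<psi> = Some q"
proof -
  note c' = charts_atD[OF c]
  define F where "F = the \<circ> local_rep A p c c \<phi>"
  define h where "h = (map_option f \<circ> \<phi>) \<circ> tangent_vector A p c"
  have "\<phi> (\<lambda>_. 0) = Some p" using E0 by (simp add: E0_def has_derivative_at_origin_def)
  then have "local_rep A p c c \<phi> 0 = Some (snd c p)"
    using c' by (simp add: local_rep_eq_Some_iff tangent_vector_zero[OF A c])
  then have F0: "F 0 = snd c p" by (simp add: F_def)
  have twice: "twice_differentiable_at F 0"
    using E1 by (simp add: E1_def partial_twice_differentiable_at_def F_def)
  have "(F has_derivative (\<lambda>y. tangent_vector A p c y c)) (at 0)"
    using E0 c unfolding E0_def has_derivative_at_origin_def F_def by blast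
  then have "(F has_derivative (\<lambda>y. y)) (at 0)"
    by (simp add: tangent_vector_apply_self[OF A c])
  then have DF: "\<forall>u. fderiv F 0 u = u"
    using has_derivative_unique twice_differentiable_at_has_derivative(1)[OF twice] by metis
  have D2F: "\<forall>u v. norm (fderiv (fderiv F) 0 u v) \<le> 2 * \<alpha> * norm u * norm v"
    using E1 norm_fderiv2_le_second_derivative_norm[OF twice] by (simp add: E1_def F_def)
  have "\<forall>\<^sub>F y in nhds 0. y \<in> dom (local_rep A p c c \<phi>)"
    using E1 by (simp add: E1_def partial_twice_differentiable_at_def)
  then have "\<forall>\<^sub>F y in nhds 0. h y = Some ((f \<circ> chart_inv c) (F y))"
  proof eventually_elim
    case (elim y)
    then obtain z where z: "local_rep A p c c \<phi> y = Some z" by blast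
    then obtain q where q: "q \<in> fst c" "\<phi> (tangent_vector A p c y) = Some q" "snd c q = z"
      unfolding local_rep_eq_Some_iff by blast
    then show ?case
      using chart_inv_apply[OF c'(1) q(1)] z by (simp add: h_def F_def)
  qed
  then obtain y where y: "newton h 0 = Some y" "Q y"
    using newton[OF twice F0 DF D2F] by blast
  obtain z where z: "local_rep A p c c \<psi> y = Some z" "norm (z - snd c p - y) \<le> \<beta> * (norm y)\<^sup>2"
    using E2 small[OF y(2)] unfolding E2_def by blast
  obtain q where q: "q \<in> fst c" "\<psi> (tangent_vector A p c y) = Some q" "snd c q = z"
    using z(1) unfolding local_rep_eq_Some_iff by blast
  show thesis
  proof (rule that[OF y(2) q(1)])
    show "norm (snd c q - snd c p - y) \<le> \<beta> * (norm y)\<^sup>2" using z q by simp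
    show "Option.bind (tangent_newton_at_origin A p (map_option f \<circ> \<phi>)) \<psi> = Some q"
      using tangent_newton_at_origin_eq[OF A c y(1)[unfolded h_def]] q by simp
  qed
qed

section \<open>Whimsical Newton methods\<close>

text \<open>In the chart \<open>c0\<close> the bound comes from the hypothesis on the Hessian, and near the origin \<open>f\<close> in
the chart \<open>c\<close> is \<open>f\<close> in the chart \<open>c0\<close> composed with the transition map.\<close>

lemma newton_defect_in_chart:
  assumes A: "C2_atlas A" and f: "C2_function A f" and crit: "critical_point A f p"
    and c0: "c0 \<in> charts_at A p" "snd c0 p = 0"
    and hess: "\<And>x. x \<in> snd c0 ` fst c0 \<Longrightarrow>
      norm ((hessian (f \<circ> chart_inv c0) x - hessian (f \<circ> chart_inv c0) 0) *v x) \<le> \<eta> * (norm x)\<^sup>2"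
    and "\<eta> \<ge> 0"
    and c: "c \<in> charts_at A p" "snd c p = 0"
  shows "\<exists>C. \<forall>\<^sub>F x in nhds 0. norm (fderiv (fderiv (f \<circ> chart_inv c)) x x
      - fderiv (f \<circ> chart_inv c) x) \<le> C * (norm x)\<^sup>2"
proof -
  note c0' = charts_atD[OF c0(1)] and c' = charts_atD[OF c(1)]
  define g where "g = f \<circ> chart_inv c"
  define g0 where "g0 = f \<circ> chart_inv c0"
  define \<tau> where "\<tau> = transition c c0"
  have C2: "C2_on g0 (snd c0 ` fst c0)"
    using f c0'(3) unfolding C2_function_def g0_def by blast
  have 0: "0 \<in> snd c0 ` fst c0" using c0'(2) c0(2) by (metis imageI)
  have "(g0 has_derivative blinfun_apply 0) (at 0)"
    using crit c0 by (auto simp: critical_point_def g0_def zero_blinfun.rep_eq)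
  then have crit0: "fderiv g0 0 = 0" by (rule fderiv_eqI)
  have defect0: "\<forall>\<^sub>F x in nhds 0. norm (fderiv (fderiv g0) x x - fderiv g0 x) \<le> 2 * \<eta> * (norm x)\<^sup>2"
  proof (rule hessian_condition_imp_newton_defect[OF _ _ 0 crit0])
    show "\<forall>x\<in>snd c0 ` fst c0. twice_differentiable_at g0 x" "open (snd c0 ` fst c0)"
      using C2 by (auto simp: C2_on_def)
  qed (use hess in \<open>simp add: g0_def\<close>)
  have "\<exists>C. \<forall>\<^sub>F x in nhds 0. norm (fderiv (fderiv (g0 \<circ> \<tau>)) x x - fderiv (g0 \<circ> \<tau>) x) \<le> C * (norm x)\<^sup>2"
  proof (rule newton_defect_compose[OF _ _ _ crit0 defect0])
    show "second_derivative_bounded_near \<tau> 0"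
      using second_derivative_bounded_near_transition[OF A c(1) c0(1)] c(2) by (simp add: \<tau>_def)
    show "\<tau> 0 = 0" using transition_apply[OF c'(1,2), of c0] c(2) c0(2) by (simp add: \<tau>_def)
    show "second_derivative_bounded_near g0 0"
      by (rule C2_on_imp_second_derivative_bounded_near[OF C2 0])
  qed (use \<open>\<eta> \<ge> 0\<close> in simp)
  then obtain C where C: "\<forall>\<^sub>F x in nhds 0.
      norm (fderiv (fderiv (g0 \<circ> \<tau>)) x x - fderiv (g0 \<circ> \<tau>) x) \<le> C * (norm x)\<^sup>2" ..
  have ev: "\<forall>\<^sub>F x in nhds 0. g x = (g0 \<circ> \<tau>) x"
    using eventually_nhds_chart[OF c'(1,2) eventually_nhds_fst_chart[OF c0'(1,2)]] unfolding c(2)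
    by eventually_elim
      (auto simp: g_def g0_def \<tau>_def transition_apply[OF c'(1)] chart_inv_apply[OF c'(1)] chart_inv_apply[OF c0'(1)])
  have "\<forall>\<^sub>F x in nhds 0. norm (fderiv (fderiv g) x x - fderiv g x) \<le> C * (norm x)\<^sup>2"
    using C eventually_fderiv_cong[OF ev] eventually_fderiv_cong[OF eventually_fderiv_cong[OF ev]]
    by eventually_elim (simp add: o_def)
  then show ?thesis unfolding g_def by blast
qed

text \<open>With \<open>x\<close>, \<open>y\<close> and \<open>z\<close> the coordinates of the point, of the Newton step and of the next iterate,
\<open>z = (z - x - y) + (x + y)\<close>: the first summand is at most \<open>\<beta> |y|\<^sup>2\<close> by E2, the second is quadratic
by the estimate for the Newton step. The constants do not depend on the method or on
the step number, since neither enters the estimates for a single pair.\<close>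

lemma whimsical_quadratic_estimate:
  assumes A: "C2_atlas A" and f: "C2_function A f" and crit: "nondegenerate_critical_point A f p0"
    and c: "c \<in> charts_at A p0" "snd c p0 = 0"
    and defect: "\<forall>\<^sub>F x in nhds 0. norm (fderiv (fderiv (f \<circ> chart_inv c)) x x
      - fderiv (f \<circ> chart_inv c) x) \<le> C * (norm x)\<^sup>2"
    and \<Sigma>: "\<And>p \<phi> \<psi>. p \<in> fst c \<Longrightarrow> (\<phi>, \<psi>) \<in> \<Sigma> p \<Longrightarrow> E0 A p \<phi> \<psi> \<and> E1 A c \<alpha> p \<phi> \<and> E2 A c \<rho> \<beta> p \<psi>"
    and "\<rho> > 0"
  obtains K where "K \<ge> 0" "\<forall>\<^sub>F x in nhds 0. \<forall>p\<in>fst c. snd c p = x \<longrightarrow>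
    (\<forall>E k. whimsical_newton_method A f \<Sigma> E \<longrightarrow>
      (\<exists>q\<in>fst c. E k p = Some q \<and> norm (snd c q) \<le> K * (norm x)\<^sup>2))"
proof -
  note c' = charts_atD[OF c(1)]
  define g where "g = f \<circ> chart_inv c"
  have C2: "C2_on g (snd c ` fst c)"
    using f c'(3) unfolding C2_function_def g_def by blast
  have 0: "0 \<in> snd c ` fst c" using c'(2) c(2) by (metis imageI)
  have op: "open (snd c ` fst c)" and td: "\<And>x. x \<in> snd c ` fst c \<Longrightarrow> twice_differentiable_at g x"
    and co: "continuous_on (snd c ` fst c) (fderiv (fderiv g))"
    using C2 unfolding C2_on_def by blast+
  have g0: "twice_differentiable_at g 0" using td 0 .
  have "(g has_derivative blinfun_apply 0) (at 0)"
    using crit c by (auto simp: nondegenerate_critical_point_def critical_point_def g_def zero_blinfun.rep_eq)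
  then have crit0: "fderiv g 0 = 0" by (rule fderiv_eqI)
  have inj: "u = 0" if "fderiv (fderiv g) 0 u = 0" for u
  proof -
    have "invertible (hessian g 0)"
      using crit c by (auto simp: nondegenerate_critical_point_def g_def)
    then show ?thesis using that invertible_hessian_iff[OF g0] by blast
  qed
  from eventually_nhds_in_open[OF op 0] have twice: "\<forall>\<^sub>F x in nhds 0. twice_differentiable_at g x"
    by eventually_elim (rule td)
  have cont: "isCont (fderiv (fderiv g)) 0"
    using co 0 unfolding continuous_on_eq_continuous_at[OF op] by blast
  from newton_step_estimate[OF twice cont crit0 inj defect[folded g_def], of "2 * \<bar>\<alpha>\<bar>"]
  \<comment> \<open>\<open>\<alpha>\<close> is replaced by its absolute value because its sign is not known\<close>
  obtain K0 where K0: "\<forall>\<^sub>F x in nhds 0. \<forall>F h. twice_differentiable_at F 0 \<longrightarrow> F 0 = x \<longrightarrow>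
    (\<forall>u. fderiv F 0 u = u) \<longrightarrow>
    (\<forall>u v. norm (fderiv (fderiv F) 0 u v) \<le> 2 * \<bar>\<alpha>\<bar> * norm u * norm v) \<longrightarrow>
    (\<forall>\<^sub>F y in nhds 0. h y = Some (g (F y))) \<longrightarrow>
    (\<exists>y. newton h 0 = Some y \<and> norm y \<le> K0 * norm x \<and> norm (x + y) \<le> K0 * (norm x)\<^sup>2)"
    by auto
  define K where "K = \<bar>K0\<bar> + \<bar>\<beta>\<bar> * K0\<^sup>2"
  have "K \<ge> 0" by (simp add: K_def)
  have small: "\<forall>\<^sub>F x :: real^'n in nhds 0. \<bar>K0\<bar> * norm x < \<rho>"
  proof -
    have "((\<lambda>x :: real^'n. \<bar>K0\<bar> * norm x) \<longlongrightarrow> \<bar>K0\<bar> * norm (0 :: real^'n)) (nhds 0)"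
      by (intro tendsto_intros filterlim_ident)
    then show ?thesis using \<open>\<rho> > 0\<close> by (intro order_tendstoD) auto
  qed
  show thesis
  proof (rule that[OF \<open>K \<ge> 0\<close>])
    from K0 small show "\<forall>\<^sub>F x in nhds 0. \<forall>p\<in>fst c. snd c p = x \<longrightarrow>
      (\<forall>E k. whimsical_newton_method A f \<Sigma> E \<longrightarrow>
        (\<exists>q\<in>fst c. E k p = Some q \<and> norm (snd c q) \<le> K * (norm x)\<^sup>2))"
    proof eventually_elim
      case (elim x)
      show ?case
      proof (intro ballI impI allI)
        fix p E k
        assume p: "p \<in> fst c" and x: "snd c p = x" and E: "whimsical_newton_method A f \<Sigma> E"
        have cp: "c \<in> charts_at A p" using c' p by (simp add: charts_at_def)
        obtain \<phi> \<psi> where pair: "(\<phi>, \<psi>) \<in> \<Sigma> p"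
          and Ek: "E k p = Option.bind (tangent_newton_at_origin A p (map_option f \<circ> \<phi>)) \<psi>"
          using E unfolding whimsical_newton_method_def by blast
        define Q where "Q = (\<lambda>y. norm y \<le> K0 * norm x \<and> norm (x + y) \<le> K0 * (norm x)\<^sup>2)"
        have conds: "E0 A p \<phi> \<psi>" "E1 A c \<bar>\<alpha>\<bar> p \<phi>" "E2 A c \<rho> \<beta> p \<psi>"
          using \<Sigma>[OF p pair] by (auto simp: E1_def)
        obtain y q where y: "Q y" and q: "q \<in> fst c" "norm (snd c q - x - y) \<le> \<beta> * (norm y)\<^sup>2"
          and Eq: "E k p = Some q"
        proof (rule whimsical_step[OF A cp conds, where Q = Q and f = f])
          show "\<exists>y. newton h 0 = Some y \<and> Q y"
            if "twice_differentiable_at F 0" "F 0 = snd c p" "\<forall>u. fderiv F 0 u = u"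
              "\<forall>u v. norm (fderiv (fderiv F) 0 u v) \<le> 2 * \<bar>\<alpha>\<bar> * norm u * norm v"
              "\<forall>\<^sub>F y in nhds 0. h y = Some ((f \<circ> chart_inv c) (F y))" for F h
            using elim(1) that unfolding Q_def x g_def by blast
          show "norm y < \<rho>" if "Q y" for y
            using that elim(2) mult_right_mono[OF abs_ge_self[of K0] norm_ge_zero[of x]]
            unfolding Q_def by linarith
        qed (use that Ek x in auto)
        have "norm (x + y) \<le> \<bar>K0\<bar> * (norm x)\<^sup>2"
          using y mult_right_mono[OF abs_ge_self[of K0], of "(norm x)\<^sup>2"] by (simp add: Q_def)
        moreover have "\<beta> * (norm y)\<^sup>2 \<le> \<bar>\<beta>\<bar> * (K0 * norm x)\<^sup>2"
          using y by (intro mult_mono power_mono) (auto simp: Q_def)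
        moreover have "norm (snd c q) \<le> norm (snd c q - x - y) + norm (x + y)"
          using norm_triangle_ineq[of "snd c q - x - y" "x + y"] by simp
        ultimately have "norm (snd c q) \<le> K * (norm x)\<^sup>2"
          using q(2) by (simp add: K_def power_mult_distrib algebra_simps)
        then show "\<exists>q\<in>fst c. E k p = Some q \<and> norm (snd c q) \<le> K * (norm x)\<^sup>2"
          using q(1) Eq by blast
      qed
    qed
  qed
qed

text \<open>Quantifying over all \<open>q\<close> in the domain with coordinates \<open>x\<close> makes the estimate usable for points
that are only known to lie in \<open>c\<close>; that they lie in \<open>d\<close> as well is part of the conclusion.\<close>

lemma chart_change_lipschitz:
  assumes A: "C2_atlas A" and c: "c \<in> charts_at A p" and d: "d \<in> charts_at A p"
  obtains L where "L \<ge> 0" "\<forall>\<^sub>F x in nhds (snd c p). \<forall>q\<in>fst c. snd c q = x \<longrightarrow>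
    q \<in> fst d \<and> norm (snd d q - snd d p) \<le> L * norm (snd c q - snd c p)"
proof -
  note c' = charts_atD[OF c] and d' = charts_atD[OF d]
  obtain L where L: "L \<ge> 0" "\<forall>\<^sub>F x in nhds (snd c p).
      norm (transition c d x - transition c d (snd c p)) \<le> L * norm (x - snd c p)"
    by (rule second_derivative_bounded_near_estimates[OF second_derivative_bounded_near_transition[OF A c d]])
      (simp add: eventually_conj_iff)
  from L(2) eventually_nhds_chart[OF c'(1,2) eventually_nhds_fst_chart[OF d'(1,2)]]
  have "\<forall>\<^sub>F x in nhds (snd c p). \<forall>q\<in>fst c. snd c q = x \<longrightarrow>
    q \<in> fst d \<and> norm (snd d q - snd d p) \<le> L * norm (snd c q - snd c p)"
  proof eventually_elim
    case (elim x)
    show ?case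
    proof (intro ballI impI)
      fix q assume q: "q \<in> fst c" "snd c q = x"
      then have "q \<in> fst d"
        using elim(2) inj_onD[OF inj_on_chart[OF c'(1)]] by metis
      then show "q \<in> fst d \<and> norm (snd d q - snd d p) \<le> L * norm (snd c q - snd c p)"
        using elim(1) q c'(2) by (auto simp: transition_apply[OF c'(1)])
    qed
  qed
  then show thesis using that L(1) by blast
qed

text \<open>The neighbourhood is a coordinate ball of the chart \<open>c\<close>, whatever the chart \<open>d\<close> in which the rate is
measured. It is so small that the quadratic estimate in \<open>c\<close> makes the distance to \<open>p0\<close> decrease,
hence the ball is mapped into itself, and that both transition maps are Lipschitz on it.\<close>

lemma whimsical_uniform_rate:
  assumes A: "C2_atlas A"
    and c: "c \<in> charts_at A p0" "snd c p0 = 0" and d: "d \<in> charts_at A p0"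
    and "K \<ge> 0"
    and est: "\<forall>\<^sub>F x in nhds 0. \<forall>p\<in>fst c. snd c p = x \<longrightarrow>
    (\<forall>E k. whimsical_newton_method A f \<Sigma> E \<longrightarrow>
      (\<exists>q\<in>fst c. E k p = Some q \<and> norm (snd c q) \<le> K * (norm x)\<^sup>2))"
  shows "\<exists>V \<kappa>. open V \<and> p0 \<in> V \<and> V \<subseteq> fst d \<and>
    (\<forall>E. whimsical_newton_method A f \<Sigma> E \<longrightarrow>
      (\<forall>k. \<forall>p\<in>V. \<exists>q. E k p = Some q \<and> q \<in> V \<and>
         norm (snd d q - snd d p0) \<le> \<kappa> * (norm (snd d p - snd d p0))\<^sup>2))"
proof -
  note c' = charts_atD[OF c(1)] and d' = charts_atD[OF d]
  obtain L where L: "L \<ge> 0" "\<forall>\<^sub>F x in nhds 0. \<forall>q\<in>fst c. snd c q = x \<longrightarrow>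
    q \<in> fst d \<and> norm (snd d q - snd d p0) \<le> L * norm (snd c q)"
    using chart_change_lipschitz[OF A c(1) d] unfolding c(2) diff_zero by blast
  obtain M where M: "M \<ge> 0" "\<forall>\<^sub>F x in nhds (snd d p0). \<forall>q\<in>fst d. snd d q = x \<longrightarrow>
    q \<in> fst c \<and> norm (snd c q) \<le> M * norm (snd d q - snd d p0)"
    using chart_change_lipschitz[OF A d c(1)] unfolding c(2) diff_zero by blast
  have "isCont (transition c d) 0"
    using has_derivative_continuous[OF has_derivative_transition[OF A c(1) d]] c(2) by simp
  moreover have "transition c d 0 = snd d p0"
    using transition_apply[OF c'(1,2), of d] c(2) by simp
  ultimately have M': "\<forall>\<^sub>F x in nhds 0. \<forall>q\<in>fst d. snd d q = transition c d x \<longrightarrow>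
    q \<in> fst c \<and> norm (snd c q) \<le> M * norm (snd d q - snd d p0)"
    using eventually_nhds_continuous[of 0 "transition c d"] M(2) by simp
  have small: "\<forall>\<^sub>F x :: real^'n in nhds 0. K * norm x < 1"
  proof -
    have "((\<lambda>x :: real^'n. K * norm x) \<longlongrightarrow> K * norm (0 :: real^'n)) (nhds 0)"
      by (intro tendsto_intros filterlim_ident)
    then show ?thesis by (intro order_tendstoD) auto
  qed
  obtain r where "r > 0" and r: "\<And>p. p \<in> fst c \<Longrightarrow> norm (snd c p) < r \<Longrightarrow>
    p \<in> fst d \<and> norm (snd d p - snd d p0) \<le> L * norm (snd c p) \<and>
    norm (snd c p) \<le> M * norm (snd d p - snd d p0) \<and> K * norm (snd c p) < 1 \<and>
    (\<forall>E k. whimsical_newton_method A f \<Sigma> E \<longrightarrow>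
      (\<exists>q\<in>fst c. E k p = Some q \<and> norm (snd c q) \<le> K * (norm (snd c p))\<^sup>2))"
  proof -
    from L(2) M' small est have "\<forall>\<^sub>F x in nhds 0. \<forall>p\<in>fst c. snd c p = x \<longrightarrow>
      p \<in> fst d \<and> norm (snd d p - snd d p0) \<le> L * norm (snd c p) \<and>
      norm (snd c p) \<le> M * norm (snd d p - snd d p0) \<and> K * norm (snd c p) < 1 \<and>
      (\<forall>E k. whimsical_newton_method A f \<Sigma> E \<longrightarrow>
        (\<exists>q\<in>fst c. E k p = Some q \<and> norm (snd c q) \<le> K * (norm (snd c p))\<^sup>2))"
    proof eventually_elim
      case (elim x)
      show ?case
      proof (intro ballI impI)
        fix p assume p: "p \<in> fst c" "snd c p = x"
        then have "snd d p = transition c d x" using transition_apply[OF c'(1)] by metis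
        then show "p \<in> fst d \<and> norm (snd d p - snd d p0) \<le> L * norm (snd c p) \<and>
          norm (snd c p) \<le> M * norm (snd d p - snd d p0) \<and> K * norm (snd c p) < 1 \<and>
          (\<forall>E k. whimsical_newton_method A f \<Sigma> E \<longrightarrow>
            (\<exists>q\<in>fst c. E k p = Some q \<and> norm (snd c q) \<le> K * (norm (snd c p))\<^sup>2))"
          using elim p by blast
      qed
    qed
    then obtain r where "r > 0" "\<And>x. dist x 0 < r \<Longrightarrow> \<forall>p\<in>fst c. snd c p = x \<longrightarrow>
      p \<in> fst d \<and> norm (snd d p - snd d p0) \<le> L * norm (snd c p) \<and>
      norm (snd c p) \<le> M * norm (snd d p - snd d p0) \<and> K * norm (snd c p) < 1 \<and>
      (\<forall>E k. whimsical_newton_method A f \<Sigma> E \<longrightarrow>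
        (\<exists>q\<in>fst c. E k p = Some q \<and> norm (snd c q) \<le> K * (norm (snd c p))\<^sup>2))"
      unfolding eventually_nhds_metric by blast
    then show thesis using that[of r] by simp
  qed
  define V where "V = fst c \<inter> snd c -` ball 0 r"
  have "open V"
    using c'(1) unfolding V_def topological_chart_def homeomorphism_def
    by (intro continuous_open_preimage) auto
  moreover have "p0 \<in> V" using c' c(2) \<open>r > 0\<close> by (simp add: V_def)
  moreover have "V \<subseteq> fst d" using r by (auto simp: V_def)
  moreover have "\<exists>q. E k p = Some q \<and> q \<in> V \<and>
      norm (snd d q - snd d p0) \<le> (L * K * M\<^sup>2) * (norm (snd d p - snd d p0))\<^sup>2"
    if E: "whimsical_newton_method A f \<Sigma> E" and p: "p \<in> V" for E k p
  proof -
    have pc: "p \<in> fst c" "norm (snd c p) < r" using p by (auto simp: V_def)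
    obtain q where q: "q \<in> fst c" "E k p = Some q" "norm (snd c q) \<le> K * (norm (snd c p))\<^sup>2"
      using r[OF pc] E by blast
    \<comment> \<open>the iterate is at most as far from \<open>p0\<close> as \<open>p\<close> is, so it stays in the ball\<close>
    have "K * (norm (snd c p))\<^sup>2 \<le> norm (snd c p)"
      using r[OF pc] mult_right_mono[of "K * norm (snd c p)" 1 "norm (snd c p)"]
      by (simp add: power2_eq_square)
    then have qr: "norm (snd c q) < r" using q(3) pc(2) by simp
    then have "q \<in> V" using q(1) by (simp add: V_def)
    have "norm (snd d q - snd d p0) \<le> L * norm (snd c q)" using r[OF q(1) qr] by blast
    also have "\<dots> \<le> L * (K * (norm (snd c p))\<^sup>2)" using q(3) L(1) by (rule mult_left_mono)
    also have "\<dots> \<le> L * (K * (M * norm (snd d p - snd d p0))\<^sup>2)"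
      using r[OF pc] L(1) \<open>K \<ge> 0\<close> by (intro mult_left_mono power_mono) auto
    also have "\<dots> = (L * K * M\<^sup>2) * (norm (snd d p - snd d p0))\<^sup>2"
      by (simp add: power_mult_distrib)
    finally show ?thesis using q(2) \<open>q \<in> V\<close> by blast
  qed
  ultimately show ?thesis by blast
qed

theorem theorem12:
  fixes A :: "('m::{t2_space, second_countable_topology}, 'n::finite) chart set"
    and f :: "'m \<Rightarrow> real" and pstar :: 'm
    and c0 :: "('m, 'n) chart" and \<eta> :: real
    and \<Sigma> :: "('m, 'n) pairs"
  assumes "C2_atlas A"
    and "C2_function A f"
    and "nondegenerate_critical_point A f pstar"
    and "c0 \<in> charts_at A pstar" and "snd c0 pstar = 0" and "\<eta> > 0"
    and "\<And>x. x \<in> snd c0 ` fst c0 \<Longrightarrow>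
      norm ((hessian (f \<circ> chart_inv c0) x - hessian (f \<circ> chart_inv c0) 0) *v x) \<le> \<eta> * (norm x)\<^sup>2"
    and "E0_E2 A \<Sigma>"
  shows "(\<forall>E. whimsical_newton_method A f \<Sigma> E \<longrightarrow>
            manifold_converges_locally_quadratically A E pstar) \<and>
         (\<forall>c\<in>charts_at A pstar. \<exists>V \<kappa>. open V \<and> pstar \<in> V \<and> V \<subseteq> fst c \<and>
            (\<forall>E. whimsical_newton_method A f \<Sigma> E \<longrightarrow>
              (\<forall>k. \<forall>p\<in>V. \<exists>q. E k p = Some q \<and> q \<in> V \<and>
                 norm (snd c q - snd c pstar) \<le> \<kappa> * (norm (snd c p - snd c pstar))\<^sup>2)))"
proof -
  have crit: "critical_point A f pstar" and "\<eta> \<ge> 0"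
    using assms(3,6) by (auto simp: nondegenerate_critical_point_def)
  obtain c \<rho> \<alpha> \<beta> where c: "c \<in> charts_at A pstar" "snd c pstar = 0" and "\<rho> > 0"
    and \<Sigma>: "\<And>p \<phi> \<psi>. p \<in> fst c \<Longrightarrow> (\<phi>, \<psi>) \<in> \<Sigma> p \<Longrightarrow> E0 A p \<phi> \<psi> \<and> E1 A c \<alpha> p \<phi> \<and> E2 A c \<rho> \<beta> p \<psi>"
    using assms(8) unfolding E0_E2_def by blast
  obtain C where C: "\<forall>\<^sub>F x in nhds 0. norm (fderiv (fderiv (f \<circ> chart_inv c)) x x
      - fderiv (f \<circ> chart_inv c) x) \<le> C * (norm x)\<^sup>2"
    using newton_defect_in_chart[OF assms(1,2) crit assms(4,5,7) \<open>\<eta> \<ge> 0\<close> c] by blast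
  obtain K where K: "K \<ge> 0" "\<forall>\<^sub>F x in nhds 0. \<forall>p\<in>fst c. snd c p = x \<longrightarrow>
    (\<forall>E k. whimsical_newton_method A f \<Sigma> E \<longrightarrow>
      (\<exists>q\<in>fst c. E k p = Some q \<and> norm (snd c q) \<le> K * (norm x)\<^sup>2))"
    using whimsical_quadratic_estimate[OF assms(1-3) c C \<Sigma> \<open>\<rho> > 0\<close>] by blast
  have uniform: "\<exists>V \<kappa>. open V \<and> pstar \<in> V \<and> V \<subseteq> fst d \<and>
      (\<forall>E. whimsical_newton_method A f \<Sigma> E \<longrightarrow>
        (\<forall>k. \<forall>p\<in>V. \<exists>q. E k p = Some q \<and> q \<in> V \<and>
           norm (snd d q - snd d pstar) \<le> \<kappa> * (norm (snd d p - snd d pstar))\<^sup>2))"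
    if "d \<in> charts_at A pstar" for d
    by (rule whimsical_uniform_rate[OF assms(1) c that K])
  have "manifold_converges_locally_quadratically A E pstar"
    if E: "whimsical_newton_method A f \<Sigma> E" for E
  proof -
    obtain V \<kappa> where V: "open V" "pstar \<in> V" "V \<subseteq> fst c"
      and step: "\<And>k p. p \<in> V \<Longrightarrow> \<exists>q. E k p = Some q \<and> q \<in> V \<and>
         norm (snd c q - snd c pstar) \<le> \<kappa> * (norm (snd c p - snd c pstar))\<^sup>2"
      using uniform[OF c(1)] E by metis
    note c' = charts_atD[OF c(1)]
    have "converges_locally_quadratically (\<lambda>k. chart_pmap c \<circ>\<^sub>m (E k \<circ>\<^sub>m chart_pinv c)) (snd c pstar)"
      unfolding converges_locally_quadratically_def
    proof (intro exI[of _ \<kappa>] exI[of _ "snd c ` V"] conjI allI ballI)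
      show "open (snd c ` V)" using open_chart_image[OF c'(1) V(1)] V(3) by (simp add: Int_absorb1)
      show "snd c pstar \<in> snd c ` V" using V(2) by blast
      fix k x assume "x \<in> snd c ` V"
      then obtain p where p: "p \<in> V" "x = snd c p" by blast
      obtain q where q: "E k p = Some q" "q \<in> V"
        "norm (snd c q - snd c pstar) \<le> \<kappa> * (norm (snd c p - snd c pstar))\<^sup>2"
        using step[OF p(1)] by blast
      have "chart_pinv c x = Some p"
        using p V(3) chart_inv_apply[OF c'(1)] by (auto simp: chart_pinv_def)
      then have "(chart_pmap c \<circ>\<^sub>m (E k \<circ>\<^sub>m chart_pinv c)) x = Some (snd c q)"
        using q V(3) by (auto simp: chart_pmap_def)
      then show "\<exists>y. (chart_pmap c \<circ>\<^sub>m (E k \<circ>\<^sub>m chart_pinv c)) x = Some y \<and> y \<in> snd c ` V \<and>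
          norm (y - snd c pstar) \<le> \<kappa> * (norm (x - snd c pstar))\<^sup>2"
        using q p by blast
    qed
    then show ?thesis
      unfolding manifold_converges_locally_quadratically_def using c(1) by blast
  qed
  then show ?thesis using uniform by blast
qed

end
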